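(* For $n\ge3$ with $n\equiv2\pmod4$ and $k\ge3$, $$p_n(\Sigma^-_k)=\sum_{i=2}^kC'(n,i)-C'(\tfrac n2,k).$$
   Context: For $\sigma\in\{+,-\}^k$ ($k\ge2$), let $\mathcal W_k$ be the set of infinite words over $\{0,\dots,k-1\}$ with the linear order $\prec_\sigma$: for $s\neq t$, with $j$ the first index where $s_j\neq t_j$ and $c=|\{i<j:\sigma_{s_i}=-\}|$, $s\prec_\sigma t$ iff ($c$ even and $s_j<t_j$) or ($c$ odd and $s_j>t_j$). The signed shift $\Sigma_\sigma$ deletes the first letter of a word. Let $\mathcal W_{k,n}$ be the set of words $(s_1\dots s_n)^\infty$ with $s_1\dots s_n$ primitive (not a power of a shorter word). For $s\in\mathcal W_{k,n}$ let $\Pi_\sigma(s)\in\mathcal S_n$ be the permutation with $\Pi_\sigma(s)_i<\Pi_\sigma(s)_j$ iff $s_is_{i+1}\dots\prec_\sigma s_js_{j+1}\dots$. Let $\mathcal P_n(\Sigma_\sigma)=\{\Pi_\sigma(s):s\in\mathcal W_{k,n}\}$ and $p_n(\Sigma_\sigma)=|\mathcal P_n(\Sigma_\sigma)|/n$ (the number of classes of $\mathcal P_n(\Sigma_\sigma)$ under cyclic rotation). $\Sigma^-_k$ denotes the reverse $k$-shift $\Sigma_{-^k}$ (all signs $-$). $C'(n,i)$ denotes the number of cyclic permutations ($n$-cycles) in $\mathcal S_n$ with exactly $i-1$ ascents, an ascent of $\tau$ being an $i\in[n-1]$ with $\tau_i<\tau_{i+1}$. *)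

theory Defs
  imports Complex_Main "HOL-Library.Stream" "HOL-Combinatorics.Permutations"
    "HOL-Combinatorics.Orbits"
begin

datatype sign = Plus | Minus

text \<open>
  A signature \<open>\<sigma> \<in> {+,-}\<^sup>k\<close> is a list of signs, so \<open>k = length \<sigma>\<close>.  Infinite words are
  streams; the letter \<open>s\<^sub>i\<close> (\<open>i \<ge> 1\<close>) of a word \<open>s\<close> is \<open>s !! (i - 1)\<close>.  The signed shift is
  \<open>stl\<close> on \<open>words k\<close> ordered by \<open>word_less \<sigma>\<close>, and \<open>sdrop\<close> is its iterate.
\<close>

definition words :: "nat \<Rightarrow> nat stream set" where
  "words k = streams {..<k}"

definition word_less :: "sign list \<Rightarrow> nat stream \<Rightarrow> nat stream \<Rightarrow> bool" where
  "word_less \<sigma> s t \<longleftrightarrow>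
     (\<exists>j. (\<forall>i<j. s !! i = t !! i) \<and> s !! j \<noteq> t !! j \<and>
        (let c = card {i. i < j \<and> \<sigma> ! (s !! i) = Minus}
         in (even c \<and> s !! j < t !! j) \<or> (odd c \<and> s !! j > t !! j)))"

definition primitive_word :: "'a list \<Rightarrow> bool" where
  "primitive_word u \<longleftrightarrow>
     u \<noteq> [] \<and> \<not> (\<exists>v m. length v < length u \<and> u = concat (replicate m v))"

definition periodic_words :: "nat \<Rightarrow> nat \<Rightarrow> nat stream set" where
  "periodic_words k n =
     {s \<in> words k. \<exists>u. length u = n \<and> primitive_word u \<and> s = cycle u}"

definition pattern :: "sign list \<Rightarrow> nat \<Rightarrow> nat stream \<Rightarrow> (nat \<Rightarrow> nat)" where
  "pattern \<sigma> n s =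
     (THE \<pi>. \<pi> permutes {1..n} \<and>
        (\<forall>i\<in>{1..n}. \<forall>j\<in>{1..n}.
           \<pi> i < \<pi> j \<longleftrightarrow> word_less \<sigma> (sdrop (i - 1) s) (sdrop (j - 1) s)))"

definition periodic_patterns :: "sign list \<Rightarrow> nat \<Rightarrow> (nat \<Rightarrow> nat) set" where
  "periodic_patterns \<sigma> n = pattern \<sigma> n ` periodic_words (length \<sigma>) n"

definition num_periodic_patterns :: "sign list \<Rightarrow> nat \<Rightarrow> real" where
  "num_periodic_patterns \<sigma> n = real (card (periodic_patterns \<sigma> n)) / real n"

definition reverse_shift :: "nat \<Rightarrow> sign list" where
  "reverse_shift k = replicate k Minus"

definition ascents :: "nat \<Rightarrow> (nat \<Rightarrow> nat) \<Rightarrow> nat set" where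
  "ascents n \<tau> = {i \<in> {1..<n}. \<tau> i < \<tau> (i + 1)}"

text \<open>\<open>cyclic_by_ascents n i\<close> is \<open>C'(n, i)\<close>; writing \<open>+ 1 = i\<close> avoids truncated
  subtraction at \<open>i = 0\<close>.\<close>

definition cyclic_by_ascents :: "nat \<Rightarrow> nat \<Rightarrow> nat" where
  "cyclic_by_ascents n i =
     card {\<tau>. \<tau> permutes {1..n} \<and> cyclic_on \<tau> {1..n} \<and> card (ascents n \<tau>) + 1 = i}"

end

theory Submission
  imports Defs
begin

text \<open>
  A pattern \<open>\<pi>\<close> of length \<open>n\<close> is encoded by the cyclic permutation \<open>\<tau>\<close> sending \<open>\<pi>\<^sub>i\<close> to \<open>\<pi>\<^sub>i\<^sub>+\<^sub>1\<close>
  (indices mod \<open>n\<close>) together with the starting point \<open>\<pi>\<^sub>1\<close>, which accounts for the factor \<open>n\<close>.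
  Labelling each position by the first letter of the shifted word of that rank, one sees that
  \<open>\<tau>\<close> is realizable iff there is a weakly increasing labelling by \<open>k\<close> letters such that \<open>\<tau>\<close>
  decreases on every fibre and distinct points have distinct itineraries.  Hence \<open>\<tau>\<close> has at most
  \<open>k - 1\<close> ascents.  With fewer ascents there is a spare letter, which can be used to isolate the
  point \<open>1\<close> and thereby to separate all points.  With exactly \<open>k - 1\<close> ascents the labelling is
  forced.  If it fails to separate points, the points with equal itinerary form intervals that
  \<open>\<tau>\<close> permutes, reversing the order at each step; the first return map to such an interval is
  monotone and cyclic, so the intervals are the pairs \<open>{2a-1, 2a}\<close>, and \<open>\<tau>\<close> is the inflation of a
  cyclic permutation of \<open>{1..n/2}\<close> with the same number of ascents.  Conversely, since \<open>n/2\<close> is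
  odd, inflating an \<open>n/2\<close>-cycle yields an \<open>n\<close>-cycle.
\<close>

subsection \<open>Cyclic permutations and rank permutations\<close>

lemma permutes_funpow:
  assumes "f permutes S"
  shows "(f ^^ i) permutes S"
proof (induction i)
  case 0
  show ?case unfolding funpow.simps by (rule permutes_id)
next
  case (Suc i)
  show ?case unfolding funpow.simps by (rule permutes_compose[OF Suc assms])
qed

text \<open>The powers below the first return time to \<open>x\<close> enumerate its orbit, which is
  \<open>S\<close>, without repetition; hence that return time equals \<open>card S\<close>.\<close>

lemma cyclic_on_funpow_card:
  assumes "cyclic_on f S" "x \<in> S"
  shows "bij_betw (\<lambda>i. (f ^^ i) x) {..<card S} S" "(f ^^ card S) x = x"
proof -
  have orb: "orbit f x = S" using assms by (rule orbit_cyclic_eq3)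
  then have xo: "x \<in> orbit f x" using assms by simp
  let ?m = "funpow_dist1 f x x"
  have inj: "inj_on (\<lambda>i. (f ^^ i) x) {..<?m}"
    using inj_on_funpow_dist1[OF xo] by (simp add: atLeast0LessThan)
  have im: "(\<lambda>i. (f ^^ i) x) ` {..<?m} = S"
    using orbit_conv_funpow_dist1[OF xo] orb by (simp add: atLeast0LessThan)
  have m: "?m = card S" using card_image[OF inj] im by simp
  show "bij_betw (\<lambda>i. (f ^^ i) x) {..<card S} S"
    using inj im m by (simp add: bij_betw_def)
  show "(f ^^ card S) x = x" using funpow_dist1_prop[OF xo] m by simp
qed

lemma cyclic_on_reach:
  assumes "cyclic_on f S" "x \<in> S" "y \<in> S"
  obtains i where "i < card S" "(f ^^ i) x = y"
proof -
  have "y \<in> (\<lambda>i. (f ^^ i) x) ` {..<card S}"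
    using cyclic_on_funpow_card(1)[OF assms(1,2)] assms(3) by (simp add: bij_betw_def)
  then show ?thesis using that by auto
qed

lemma cyclic_on_funpow_mod:
  assumes "cyclic_on f S" "x \<in> S"
  shows "(f ^^ (i mod card S)) x = (f ^^ i) x"
  using cyclic_on_funpow_card(2)[OF assms] by (rule funpow_mod_eq)

lemma cyclic_on_funpow_eq_self_iff:
  assumes "cyclic_on f S" "x \<in> S"
  shows "(f ^^ i) x = x \<longleftrightarrow> card S dvd i"
proof
  assume "(f ^^ i) x = x"
  then have "(f ^^ (i mod card S)) x = (f ^^ 0) x"
    using cyclic_on_funpow_mod[OF assms] by simp
  moreover have "card S > 0" using assms finite_cyclic_on card_gt_0_iff by blast
  ultimately have "i mod card S = 0"
    using cyclic_on_funpow_card(1)[OF assms] unfolding bij_betw_def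
    by (meson inj_onD lessThan_iff mod_less_divisor)
  then show "card S dvd i" by (simp add: mod_eq_0_iff_dvd)
next
  assume "card S dvd i"
  then show "(f ^^ i) x = x" using cyclic_on_funpow_mod[OF assms, of i]
    by (simp add: dvd_eq_mod_eq_0)
qed

section \<open>Permutations as rank functions of linear orders\<close>

lemma permutes_eq_card_below:
  fixes \<pi> :: "nat \<Rightarrow> nat"
  assumes "\<pi> permutes {1..n}" "x \<in> {1..n}"
  shows "\<pi> x = Suc (card {y \<in> {1..n}. \<pi> y < \<pi> x})"
proof -
  have "\<pi> ` {y \<in> {1..n}. \<pi> y < \<pi> x} = {1..<\<pi> x}" (is "?L = ?R")
  proof
    show "?L \<subseteq> ?R" using permutes_in_image[OF assms(1)] by fastforce
    show "?R \<subseteq> ?L"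
    proof
      fix z assume z: "z \<in> ?R"
      have "\<pi> x \<in> {1..n}" using permutes_in_image[OF assms(1)] assms(2) by blast
      then have "z \<in> \<pi> ` {1..n}" using z permutes_image[OF assms(1)] by simp
      then show "z \<in> ?L" using z by auto
    qed
  qed
  then have "card {y \<in> {1..n}. \<pi> y < \<pi> x} = card {1..<\<pi> x}"
    by (metis card_image inj_on_subset permutes_inj[OF assms(1)] subset_UNIV)
  moreover have "\<pi> x \<ge> 1" using permutes_in_image[OF assms(1)] assms(2) by fastforce
  ultimately show ?thesis by simp
qed

text \<open>A value is one more than the number of smaller values, so the comparisons alone
  determine it. This is the uniqueness behind the definite description in
  \<open>pattern\<close>.\<close>

lemma permutes_order_unique:
  fixes \<pi> \<rho> :: "nat \<Rightarrow> nat"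
  assumes "\<pi> permutes {1..n}" "\<rho> permutes {1..n}"
    and "\<And>x y. x \<in> {1..n} \<Longrightarrow> y \<in> {1..n} \<Longrightarrow> \<pi> x < \<pi> y \<longleftrightarrow> \<rho> x < \<rho> y"
  shows "\<pi> = \<rho>"
proof
  fix x
  show "\<pi> x = \<rho> x"
  proof (cases "x \<in> {1..n}")
    case True
    then have "{y \<in> {1..n}. \<pi> y < \<pi> x} = {y \<in> {1..n}. \<rho> y < \<rho> x}"
      using assms(3) by blast
    then show ?thesis
      using permutes_eq_card_below[OF assms(1) True] permutes_eq_card_below[OF assms(2) True]
      by simp
  next
    case False
    then show ?thesis using assms(1,2) by (metis permutes_not_in)
  qed
qed

lemma permutes_of_strict_linear_order:
  fixes r :: "nat \<Rightarrow> nat \<Rightarrow> bool"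
  assumes irr: "\<And>x. x \<in> {1..n} \<Longrightarrow> \<not> r x x"
    and tr: "\<And>x y z. \<lbrakk>x \<in> {1..n}; y \<in> {1..n}; z \<in> {1..n}; r x y; r y z\<rbrakk> \<Longrightarrow> r x z"
    and tot: "\<And>x y. \<lbrakk>x \<in> {1..n}; y \<in> {1..n}; x \<noteq> y\<rbrakk> \<Longrightarrow> r x y \<or> r y x"
  obtains \<pi> where "\<pi> permutes {1..n}"
    "\<And>x y. x \<in> {1..n} \<Longrightarrow> y \<in> {1..n} \<Longrightarrow> \<pi> x < \<pi> y \<longleftrightarrow> r x y"
proof -
  \<comment> \<open>The rank in the order \<open>r\<close>, counted from 1, and the identity off
    \<open>{1..n}\<close> so that it permutes that set.\<close>
  define \<pi> where "\<pi> x = (if x \<in> {1..n} then Suc (card {y \<in> {1..n}. r y x}) else x)" for x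
  have less: "\<pi> x < \<pi> y" if "x \<in> {1..n}" "y \<in> {1..n}" "r x y" for x y
  proof -
    have "{z \<in> {1..n}. r z x} \<subset> {z \<in> {1..n}. r z y}"
      using that irr tr by blast
    then show ?thesis using that by (simp add: \<pi>_def psubset_card_mono)
  qed
  have iff: "\<pi> x < \<pi> y \<longleftrightarrow> r x y" if "x \<in> {1..n}" "y \<in> {1..n}" for x y
    using less[OF that] less[OF that(2,1)] tot[OF that] by (metis less_asym' less_irrefl)
  have inj: "inj_on \<pi> {1..n}"
    by (rule inj_onI) (metis iff less_irrefl tot)
  have "\<pi> x \<in> {1..n}" if "x \<in> {1..n}" for x
  proof -
    have "{y \<in> {1..n}. r y x} \<subset> {1..n}" using that irr by blast
    then have "card {y \<in> {1..n}. r y x} < card {1..n}" by (intro psubset_card_mono) auto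
    then show ?thesis using that by (simp add: \<pi>_def)
  qed
  then have "\<pi> ` {1..n} = {1..n}" using inj by (intro endo_inj_surj) auto
  then have "\<pi> permutes {1..n}"
    using inj by (intro bij_imp_permutes) (auto simp: bij_betw_def \<pi>_def)
  then show ?thesis using that iff by blast
qed

subsection \<open>The alternating order on words\<close>

text \<open>When every sign is \<open>Minus\<close>, the count \<open>c\<close> in
  \<open>word_less\<close> is the index \<open>j\<close> itself, so its parity decides the
  direction. Stated for functions so that words and itineraries can be compared alike.\<close>

definition alt_less :: "(nat \<Rightarrow> nat) \<Rightarrow> (nat \<Rightarrow> nat) \<Rightarrow> bool" where
  "alt_less f g \<longleftrightarrow>
     (\<exists>j. (\<forall>i<j. f i = g i) \<and> (if even j then f j < g j else g j < f j))"

lemma word_less_reverse_shift: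
  assumes "s \<in> words k"
  shows "word_less (reverse_shift k) s t \<longleftrightarrow> alt_less (snth s) (snth t)"
proof -
  have "s !! i < k" for i
    using assms by (auto simp: words_def streams_iff_snth)
  then have "{i. i < j \<and> reverse_shift k ! (s !! i) = Minus} = {..<j}" for j
    by (auto simp: reverse_shift_def)
  then show ?thesis
    unfolding word_less_def alt_less_def Let_def by (auto split: if_splits)
qed

lemma alt_less_irrefl: "\<not> alt_less f f"
  by (auto simp: alt_less_def split: if_splits)

lemma alt_less_trans:
  assumes "alt_less f g" "alt_less g h"
  shows "alt_less f h"
proof -
  obtain i where i: "\<And>l. l < i \<Longrightarrow> f l = g l" "if even i then f i < g i else g i < f i"
    using assms(1) by (auto simp: alt_less_def)
  obtain j where j: "\<And>l. l < j \<Longrightarrow> g l = h l" "if even j then g j < h j else h j < g j"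
    using assms(2) by (auto simp: alt_less_def)
  \<comment> \<open>The sequences \<open>f\<close> and \<open>h\<close> first differ at
    \<open>min i j\<close>; if \<open>i = j\<close>, both strict inequalities there point the same
    way.\<close>
  consider "i < j" | "i = j" | "j < i" by linarith
  then have "if even (min i j) then f (min i j) < h (min i j) else h (min i j) < f (min i j)"
  proof cases
    case 1 then show ?thesis using i(2) j(1)[of i] by (auto simp: min_def split: if_splits)
  next
    case 2 then show ?thesis using i(2) j(2) by (auto split: if_splits)
  next
    case 3 then show ?thesis using i(1)[of j] j(2) by (auto simp: min_def split: if_splits)
  qed
  moreover have "\<forall>l<min i j. f l = h l" using i(1) j(1) by simp
  ultimately show ?thesis unfolding alt_less_def by blast
qed

lemma alt_less_asym: "alt_less f g \<Longrightarrow> \<not> alt_less g f"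
  using alt_less_trans alt_less_irrefl by blast

lemma first_difference:
  fixes f g :: "nat \<Rightarrow> 'a"
  assumes "f \<noteq> g"
  obtains j where "\<And>i. i < j \<Longrightarrow> f i = g i" "f j \<noteq> g j"
proof -
  have "\<exists>j. f j \<noteq> g j" using assms by auto
  then show ?thesis using that[of "LEAST j. f j \<noteq> g j"]
    by (metis (mono_tags, lifting) LeastI_ex not_less_Least)
qed

lemma alt_less_total:
  assumes "f \<noteq> g"
  shows "alt_less f g \<or> alt_less g f"
proof -
  obtain j where j: "\<And>i. i < j \<Longrightarrow> f i = g i" "f j \<noteq> g j"
    using first_difference[OF assms] by blast
  show ?thesis
  proof (cases "f j < g j \<longleftrightarrow> even j")
    case True
    then have "alt_less f g" using j unfolding alt_less_def by (intro exI[of _ j]) auto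
    then show ?thesis ..
  next
    case False
    then have "alt_less g f" using j unfolding alt_less_def by (intro exI[of _ j]) auto
    then show ?thesis ..
  qed
qed

lemma alt_less_head:
  assumes "alt_less f g"
  shows "f 0 \<le> g 0"
proof -
  obtain j where "\<And>l. l < j \<Longrightarrow> f l = g l" "if even j then f j < g j else g j < f j"
    using assms by (auto simp: alt_less_def)
  then show ?thesis by (cases "j = 0") auto
qed

text \<open>Deleting a common first letter moves the first difference one place forward and flips
  its parity, so the order reverses.\<close>

lemma alt_less_tail:
  assumes "alt_less f g" "f 0 = g 0"
  shows "alt_less (\<lambda>i. g (Suc i)) (\<lambda>i. f (Suc i))"
proof -
  obtain j where j: "\<And>l. l < j \<Longrightarrow> f l = g l" "if even j then f j < g j else g j < f j"
    using assms(1) by (auto simp: alt_less_def)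
  obtain m where "j = Suc m" using j(2) assms(2) by (cases j) auto
  then show ?thesis unfolding alt_less_def
    using j by (intro exI[of _ m]) auto
qed

subsection \<open>Realizable cyclic permutations\<close>

definition cyclic_perms :: "nat \<Rightarrow> (nat \<Rightarrow> nat) set" where
  "cyclic_perms n = {\<tau>. \<tau> permutes {1..n} \<and> cyclic_on \<tau> {1..n}}"

text \<open>The two clauses mirror \<open>alt_less_head\<close> (first letters increase weakly with
  rank) and \<open>alt_less_tail\<close> (equal first letters reverse the order of the shifted
  words).\<close>

definition descending_labelling :: "nat \<Rightarrow> (nat \<Rightarrow> nat) \<Rightarrow> (nat \<Rightarrow> nat) \<Rightarrow> bool" where
  "descending_labelling n \<tau> L \<longleftrightarrow> mono_on {1..n} L \<and>
     (\<forall>x\<in>{1..n}. \<forall>y\<in>{1..n}. x < y \<and> L x = L y \<longrightarrow> \<tau> y < \<tau> x)"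

definition itinerary :: "(nat \<Rightarrow> nat) \<Rightarrow> (nat \<Rightarrow> nat) \<Rightarrow> nat \<Rightarrow> nat \<Rightarrow> nat" where
  "itinerary \<tau> L x = (\<lambda>i. L ((\<tau> ^^ i) x))"

definition realizable :: "nat \<Rightarrow> nat \<Rightarrow> (nat \<Rightarrow> nat) set" where
  "realizable n k = {\<tau> \<in> cyclic_perms n. \<exists>L. L ` {1..n} \<subseteq> {..<k} \<and>
     descending_labelling n \<tau> L \<and> inj_on (itinerary \<tau> L) {1..n}}"

text \<open>The pattern with first entry \<open>a\<close> whose successive entries are related by
  \<open>\<tau>\<close>. The exponent \<open>i - 1\<close> reflects that positions start at
  1.\<close>

definition orbit_listing :: "nat \<Rightarrow> (nat \<Rightarrow> nat) \<Rightarrow> nat \<Rightarrow> nat \<Rightarrow> nat" where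
  "orbit_listing n \<tau> a = (\<lambda>i. if i \<in> {1..n} then (\<tau> ^^ (i - 1)) a else i)"

lemma orbit_listing_permutes:
  assumes "\<tau> \<in> cyclic_perms n" "a \<in> {1..n}"
  shows "orbit_listing n \<tau> a permutes {1..n}"
proof -
  have b: "bij_betw (\<lambda>i. (\<tau> ^^ i) a) {..<n} {1..n}"
    using cyclic_on_funpow_card(1)[of \<tau> "{1..n}" a] assms by (simp add: cyclic_perms_def)
  have "bij_betw (\<lambda>i. i - 1) {1..n} {..<n}"
    by (rule bij_betwI[where g=Suc]) auto
  from bij_betw_trans[OF this b] have "bij_betw (orbit_listing n \<tau> a) {1..n} {1..n}"
    by (subst bij_betw_cong[where g="(\<lambda>i. (\<tau> ^^ i) a) \<circ> (\<lambda>i. i - 1)"])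
       (auto simp: orbit_listing_def)
  then show ?thesis by (rule bij_imp_permutes) (auto simp: orbit_listing_def)
qed

lemma inj_on_orbit_listing:
  "inj_on (\<lambda>(\<tau>, a). orbit_listing n \<tau> a) (cyclic_perms n \<times> {1..n})"
proof (rule inj_onI, clarify)
  fix \<tau> a \<rho> b
  assume \<tau>: "\<tau> \<in> cyclic_perms n" and a: "a \<in> {1..n}" and \<rho>: "\<rho> \<in> cyclic_perms n"
    and b: "b \<in> {1..n}" and eq: "orbit_listing n \<tau> a = orbit_listing n \<rho> b"
  have pw: "(\<tau> ^^ i) a = (\<rho> ^^ i) b" if "i < n" for i
    using fun_cong[OF eq, of "Suc i"] that by (simp add: orbit_listing_def)
  have "n > 0" using a by simp
  with pw[of 0] have ab: "a = b" by simp
  have c: "cyclic_on \<tau> {1..n}" "cyclic_on \<rho> {1..n}" using \<tau> \<rho> by (auto simp: cyclic_perms_def)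
  \<comment> \<open>The listings compare only exponents below \<open>n\<close>; both permutations
    have period \<open>n\<close> at \<open>a\<close>, so agreement extends to all exponents, and
    these reach every point.\<close>
  have pw': "(\<tau> ^^ i) a = (\<rho> ^^ i) a" for i
    using cyclic_on_funpow_mod[OF c(1) a, of i] cyclic_on_funpow_mod[OF c(2) a, of i]
      pw[of "i mod n"] ab \<open>n > 0\<close> by simp
  have "\<tau> x = \<rho> x" for x
  proof (cases "x \<in> {1..n}")
    case True
    then obtain i where "(\<tau> ^^ i) a = x" using cyclic_on_reach[OF c(1) a] by metis
    then show ?thesis using pw'[of i] pw'[of "Suc i"] by simp
  next
    case False
    then have "\<tau> x = x" "\<rho> x = x"
      using \<tau> \<rho> permutes_not_in unfolding cyclic_perms_def by fastforce+
    then show ?thesis by simp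
  qed
  then show "\<tau> = \<rho> \<and> a = b" using ab by auto
qed

lemma pattern_eqI:
  assumes s: "s \<in> words k" and \<pi>: "\<pi> permutes {1..n}"
    and ord: "\<And>i j. i \<in> {1..n} \<Longrightarrow> j \<in> {1..n} \<Longrightarrow>
      \<pi> i < \<pi> j \<longleftrightarrow> alt_less (snth (sdrop (i - 1) s)) (snth (sdrop (j - 1) s))"
  shows "pattern (reverse_shift k) n s = \<pi>"
proof -
  have "sdrop i s \<in> words k" for i
    using s by (auto simp: words_def streams_iff_snth sdrop_snth)
  then have w: "word_less (reverse_shift k) (sdrop i s) (sdrop j s) \<longleftrightarrow>
      alt_less (snth (sdrop i s)) (snth (sdrop j s))" for i j
    by (rule word_less_reverse_shift)
  show ?thesis unfolding pattern_def w
  proof (rule the_equality)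
    show "\<pi> permutes {1..n} \<and> (\<forall>i\<in>{1..n}. \<forall>j\<in>{1..n}.
        \<pi> i < \<pi> j \<longleftrightarrow> alt_less (snth (sdrop (i - 1) s)) (snth (sdrop (j - 1) s)))"
      using \<pi> ord by blast
  next
    fix \<rho> assume "\<rho> permutes {1..n} \<and> (\<forall>i\<in>{1..n}. \<forall>j\<in>{1..n}.
        \<rho> i < \<rho> j \<longleftrightarrow> alt_less (snth (sdrop (i - 1) s)) (snth (sdrop (j - 1) s)))"
    then show "\<rho> = \<pi>" using \<pi> ord by (intro permutes_order_unique[of \<rho> n \<pi>]) auto
  qed
qed

text \<open>As long as the labels agree, each application of \<open>\<tau>\<close> swaps the order
  of the two orbit points. At the first difference \<open>j\<close> their order is thus known from
  the parity of \<open>j\<close>, and monotonicity carries it over to the labels.\<close>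

lemma itinerary_strict_mono:
  assumes perm: "\<tau> permutes {1..n}" and L: "descending_labelling n \<tau> L"
    and inj: "inj_on (itinerary \<tau> L) {1..n}"
    and xy: "x \<in> {1..n}" "y \<in> {1..n}" "x < y"
  shows "alt_less (itinerary \<tau> L x) (itinerary \<tau> L y)"
proof -
  have mono: "mono_on {1..n} L" using L by (simp add: descending_labelling_def)
  have "itinerary \<tau> L x \<noteq> itinerary \<tau> L y" using inj xy by (metis inj_onD less_irrefl)
  then obtain j where j: "\<And>i. i < j \<Longrightarrow> L ((\<tau> ^^ i) x) = L ((\<tau> ^^ i) y)"
      "L ((\<tau> ^^ j) x) \<noteq> L ((\<tau> ^^ j) y)"
    by (rule first_difference) (auto simp: itinerary_def)
  have in_dom: "(\<tau> ^^ i) z \<in> {1..n}" if "z \<in> {1..n}" for i z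
    using permutes_in_image[OF permutes_funpow[OF perm]] that by blast
  have "if even i then (\<tau> ^^ i) x < (\<tau> ^^ i) y else (\<tau> ^^ i) y < (\<tau> ^^ i) x" if "i \<le> j" for i
    using that
  proof (induction i)
    case 0 then show ?case using xy by simp
  next
    case (Suc i)
    then show ?case
      using L j(1)[of i] in_dom[OF xy(1), of i] in_dom[OF xy(2), of i]
      by (auto simp: descending_labelling_def split: if_splits)
  qed
  from this[of j] have "if even j then L ((\<tau> ^^ j) x) < L ((\<tau> ^^ j) y)
      else L ((\<tau> ^^ j) y) < L ((\<tau> ^^ j) x)"
    using mono_onD[OF mono in_dom[OF xy(1), of j] in_dom[OF xy(2), of j]]
      mono_onD[OF mono in_dom[OF xy(2), of j] in_dom[OF xy(1), of j]] j(2)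
    by (simp split: if_splits)
  then show ?thesis using j(1) unfolding alt_less_def itinerary_def by blast
qed

section \<open>Periods of infinite words and primitivity\<close>

lemma sdrop_mult_period:
  assumes "sdrop p s = s"
  shows "sdrop (p * m) s = s"
proof (induction m)
  case (Suc m)
  have "sdrop (p * Suc m) s = sdrop (p * m) (sdrop p s)" by simp
  then show ?case using Suc assms by simp
qed simp

text \<open>Bezout in the natural numbers: dropping \<open>gcd p q\<close> letters after
  \<open>q * y\<close> letters amounts to dropping \<open>p * x\<close> letters. This form needs
  \<open>p\<close> nonzero, hence the case split.\<close>

lemma sdrop_gcd_period:
  assumes "sdrop p s = s" "sdrop q s = s"
  shows "sdrop (gcd p q) s = s"
proof (cases "p = 0")
  case False
  then obtain x y where xy: "p * x = q * y + gcd p q" using bezout_nat by blast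
  have "sdrop (gcd p q) s = sdrop (gcd p q) (sdrop (q * y) s)"
    using sdrop_mult_period[OF assms(2)] by simp
  also have "\<dots> = sdrop (p * x) s" using xy by simp
  also have "\<dots> = s" using sdrop_mult_period[OF assms(1)] .
  finally show ?thesis .
qed (use assms in simp)

lemma stake_mult_period:
  assumes "sdrop p s = s"
  shows "stake (p * m) s = concat (replicate m (stake p s))"
proof (induction m)
  case (Suc m)
  have "stake (p * Suc m) s = stake p s @ stake (p * m) (sdrop p s)" by simp
  then show ?case using Suc assms by simp
qed simp

text \<open>Both \<open>p\<close> and \<open>length u\<close> are periods, hence so is their gcd,
  and \<open>u\<close> is a power of its prefix of that length. Primitivity leaves only the full
  length.\<close>

lemma sdrop_cycle_primitive_eq_self:
  assumes "primitive_word u" "sdrop p (cycle u) = cycle u"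
  shows "length u dvd p"
proof -
  have u: "u \<noteq> []" using assms(1) by (simp add: primitive_word_def)
  let ?g = "gcd p (length u)"
  have "sdrop ?g (cycle u) = cycle u"
    using assms(2) u by (intro sdrop_gcd_period) auto
  from stake_mult_period[OF this, of "length u div ?g"]
  have "u = concat (replicate (length u div ?g) (stake ?g (cycle u)))" using u by simp
  then have "\<not> ?g < length u" using assms(1) unfolding primitive_word_def
    by (metis length_stake)
  then have "?g = length u" using u by (meson gcd_le2_nat le_neq_implies_less length_0_conv)
  then show ?thesis by (metis gcd_dvd1)
qed

lemma sdrop_cycle_primitive_inj:
  assumes u: "primitive_word u" and ij: "i < length u" "j < length u"
    and eq: "sdrop i (cycle u) = sdrop j (cycle u)"
  shows "i = j"
proof -
  have *: "i = j" if "i \<le> j" "j < length u" "sdrop i (cycle u) = sdrop j (cycle u)" for i j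
  proof -
    have "u \<noteq> []" using that by auto
    then have c: "sdrop (length u) (cycle u) = cycle u" by simp
    \<comment> \<open>Dropping a further \<open>length u - i\<close> letters completes a full period
      on the side of \<open>i\<close> and leaves an excess shift \<open>j - i\<close> on the side of
      \<open>j\<close>.\<close>
    have "sdrop (length u) (cycle u) = sdrop (length u - i) (sdrop i (cycle u))"
      using that(1,2) by simp
    also have "\<dots> = sdrop (length u - i) (sdrop j (cycle u))" using that(3) by (rule arg_cong)
    also have "\<dots> = sdrop (j - i) (sdrop (length u) (cycle u))" using that(1,2) by (simp add: add.commute)
    finally have "sdrop (j - i) (cycle u) = cycle u" using c by simp
    then have "length u dvd j - i" using sdrop_cycle_primitive_eq_self[OF u] by blast
    then show ?thesis using that(1,2) by (auto dest: dvd_imp_le)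
  qed
  show ?thesis using *[of i j] *[of j i] ij eq by (cases "i \<le> j") auto
qed

lemma snth_cycle:
  assumes "u \<noteq> []"
  shows "cycle u !! i = u ! (i mod length u)"
proof -
  have "cycle u !! i = shd (sdrop i (cycle u))" by simp
  also have "\<dots> = hd (rotate (i mod length u) u)" using assms by (simp add: sdrop_cycle del: sdrop_simps)
  also have "\<dots> = u ! (i mod length u)" using assms by (simp add: hd_rotate_conv_nth)
  finally show ?thesis .
qed

lemma snth_cycle_concat_replicate:
  assumes "u = concat (replicate m v)" "u \<noteq> []"
  shows "cycle u !! i = v ! (i mod length v)"
proof -
  have v: "v \<noteq> []" "m > 0" using assms by auto
  have len: "length u = m * length v" using assms(1) by (simp add: length_concat sum_list_replicate)
  have "u = stake (length u) (cycle v)" using assms(1) v len by simp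
  then have "u ! (i mod length u) = cycle v !! (i mod length u)"
    using assms(2) by (metis length_greater_0_conv mod_less_divisor stake_nth)
  then show ?thesis using snth_cycle[OF assms(2)] snth_cycle[OF v(1)] len
    by (simp add: mod_mod_cancel)
qed

section \<open>Patterns correspond to realizable permutations with a starting point\<close>

lemma itinerary_funpow: "itinerary \<tau> L ((\<tau> ^^ i) x) j = itinerary \<tau> L x (i + j)"
  by (simp add: itinerary_def funpow_add add.commute[of i])

lemma orbit_listing_in_periodic_patterns:
  assumes "\<tau> \<in> realizable n k" "a \<in> {1..n}"
  shows "orbit_listing n \<tau> a \<in> periodic_patterns (reverse_shift k) n"
proof -
  obtain L where L: "L ` {1..n} \<subseteq> {..<k}" "descending_labelling n \<tau> L"
      "inj_on (itinerary \<tau> L) {1..n}"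
    and \<tau>: "\<tau> \<in> cyclic_perms n"
    using assms(1) by (auto simp: realizable_def)
  have perm: "\<tau> permutes {1..n}" and cyc: "cyclic_on \<tau> {1..n}"
    using \<tau> by (auto simp: cyclic_perms_def)
  have n: "n > 0" using assms(2) by simp
  define u where "u = map (itinerary \<tau> L a) [0..<n]"
  define s where "s = cycle u"
  have u: "u \<noteq> []" "length u = n" using n by (auto simp: u_def)
  have snth_s: "s !! i = itinerary \<tau> L a i" for i
    using snth_cycle[OF u(1), of i] cyclic_on_funpow_mod[OF cyc assms(2), of i] n
    by (simp add: s_def u_def itinerary_def)
  have in_dom: "(\<tau> ^^ i) a \<in> {1..n}" for i
    using cyclic_on_funpow_in[OF cyc assms(2)] .
  have s: "s \<in> words k"
    using in_dom L(1) by (fastforce simp: words_def streams_iff_snth snth_s itinerary_def)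
  have drop: "snth (sdrop i s) = itinerary \<tau> L ((\<tau> ^^ i) a)" for i
    by (rule ext) (simp add: sdrop_snth snth_s itinerary_funpow)
  \<comment> \<open>If \<open>u\<close> were a power of a shorter \<open>v\<close>, then
    \<open>a\<close> and its image under \<open>length v\<close> steps would share their itinerary
    and so coincide, forcing \<open>n\<close> to divide a positive number below
    \<open>n\<close>.\<close>
  have prim: "primitive_word u"
  proof (rule ccontr)
    assume "\<not> primitive_word u"
    then obtain v m where v: "length v < length u" "u = concat (replicate m v)"
      using u by (auto simp: primitive_word_def)
    then have "v \<noteq> []" using u by auto
    have "itinerary \<tau> L ((\<tau> ^^ length v) a) i = itinerary \<tau> L a i" for i
      using snth_cycle_concat_replicate[OF v(2) u(1)] snth_s
      by (simp add: itinerary_funpow s_def flip: snth_s)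
    then have "(\<tau> ^^ length v) a = a"
      using L(3) in_dom assms(2) by (meson ext inj_onD)
    then have "n dvd length v" using cyclic_on_funpow_eq_self_iff[OF cyc assms(2)] by simp
    then show False using v u \<open>v \<noteq> []\<close> by (simp add: nat_dvd_not_less)
  qed
  have "s \<in> periodic_words k n"
    using s prim u by (auto simp: periodic_words_def s_def)
  moreover have "pattern (reverse_shift k) n s = orbit_listing n \<tau> a"
  proof (rule pattern_eqI[OF s orbit_listing_permutes[OF \<tau> assms(2)]])
    fix i j assume ij: "i \<in> {1..n}" "j \<in> {1..n}"
    let ?x = "(\<tau> ^^ (i - 1)) a" and ?y = "(\<tau> ^^ (j - 1)) a"
    have "?x < ?y \<longleftrightarrow> alt_less (itinerary \<tau> L ?x) (itinerary \<tau> L ?y)"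
      using itinerary_strict_mono[OF perm L(2,3) in_dom in_dom, of "i - 1" "j - 1"]
        itinerary_strict_mono[OF perm L(2,3) in_dom in_dom, of "j - 1" "i - 1"]
        alt_less_asym alt_less_irrefl by (metis linorder_neqE_nat)
    then show "orbit_listing n \<tau> a i < orbit_listing n \<tau> a j \<longleftrightarrow>
        alt_less (snth (sdrop (i - 1) s)) (snth (sdrop (j - 1) s))"
      using ij by (simp add: orbit_listing_def drop)
  qed
  ultimately show ?thesis
    unfolding periodic_patterns_def by (auto simp: reverse_shift_def intro!: image_eqI[of _ _ s])
qed

lemma pattern_is_orbit_listing:
  assumes "s \<in> periodic_words k n"
  obtains \<tau> a where "\<tau> \<in> realizable n k" "a \<in> {1..n}"
    "pattern (reverse_shift k) n s = orbit_listing n \<tau> a"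
proof -
  obtain u where u: "length u = n" "primitive_word u" "s = cycle u" and s: "s \<in> words k"
    using assms by (auto simp: periodic_words_def)
  have "u \<noteq> []" using u(2) by (simp add: primitive_word_def)
  then have n: "n > 0" using u(1) by auto
  have mod: "s !! (i mod n) = s !! i" for i
    using snth_cycle[OF \<open>u \<noteq> []\<close>] u by simp
  define W where "W i = snth (sdrop (i - 1) s)" for i
  have W_nth: "W x i = s !! (x - 1 + i)" for x i by (simp add: W_def sdrop_snth)
  have W_inj: "x = y" if "x \<in> {1..n}" "y \<in> {1..n}" "W x = W y" for x y
  proof -
    have "sdrop (x - 1) (cycle u) = sdrop (y - 1) (cycle u)"
      using that(3) u(3) unfolding W_def by (metis smap_alt stream.map_id0 id_apply)
    then have "x - 1 = y - 1" using that u by (intro sdrop_cycle_primitive_inj[of u]) auto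
    then show ?thesis using that by auto
  qed
  obtain \<pi> where \<pi>: "\<pi> permutes {1..n}"
    and ord: "\<And>x y. x \<in> {1..n} \<Longrightarrow> y \<in> {1..n} \<Longrightarrow> \<pi> x < \<pi> y \<longleftrightarrow> alt_less (W x) (W y)"
  proof (rule permutes_of_strict_linear_order[of n "\<lambda>x y. alt_less (W x) (W y)"])
    show "alt_less (W x) (W y) \<or> alt_less (W y) (W x)"
      if "x \<in> {1..n}" "y \<in> {1..n}" "x \<noteq> y" for x y
      using alt_less_total[of "W x" "W y"] W_inj that by blast
  qed (use alt_less_irrefl alt_less_trans in blast)+
  have pat: "pattern (reverse_shift k) n s = \<pi>"
    using ord by (intro pattern_eqI[OF s \<pi>]) (auto simp: W_def)
  \<comment> \<open>The cyclic successor on positions; conjugating it by \<open>\<pi>\<close> below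
    turns it into the map on ranks.\<close>
  define nxt where "nxt i = (if i \<in> {1..<n} then i + 1 else if i = n then 1 else i)" for i
  have nxt: "nxt permutes {1..n}"
  proof (rule bij_imp_permutes)
    have "nxt ` {1..n} \<subseteq> {1..n}" "inj_on nxt {1..n}"
      using n by (auto simp: nxt_def inj_on_def)
    then show "bij_betw nxt {1..n} {1..n}" by (simp add: bij_betw_def endo_inj_surj)
    show "\<And>x. x \<notin> {1..n} \<Longrightarrow> nxt x = x" using n by (auto simp: nxt_def)
  qed
  have nxt_pow: "(nxt ^^ i) x = (x - 1 + i) mod n + 1" if "x \<in> {1..n}" for x i
  proof (induction i)
    case 0
    have "(x - 1) mod n = x - 1" using that by (intro mod_less) auto
    then show ?case using that by simp
  next
    case (Suc i)
    have "nxt (m mod n + 1) = Suc m mod n + 1" for m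
      using n mod_less_divisor[OF n, of m] by (auto simp: nxt_def mod_Suc)
    then show ?case using Suc by simp
  qed
  define \<tau> where "\<tau> = \<pi> \<circ> nxt \<circ> inv \<pi>"
  \<comment> \<open>The label of a rank is the first letter of the shifted word having that
    rank.\<close>
  define L where "L x = s !! (inv \<pi> x - 1)" for x
  have inv[simp]: "inv \<pi> (\<pi> x) = x" for x using \<pi> by (rule permutes_inverses(2))
  have \<tau>\<pi>: "\<tau> (\<pi> x) = \<pi> (nxt x)" for x by (simp add: \<tau>_def)
  have pow: "(\<tau> ^^ i) (\<pi> x) = \<pi> ((nxt ^^ i) x)" for i x
    by (induction i) (auto simp: \<tau>\<pi>)
  have perm: "\<tau> permutes {1..n}"
    unfolding \<tau>_def by (intro permutes_compose permutes_inv \<pi> nxt)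
  have \<pi>in: "\<pi> x \<in> {1..n} \<longleftrightarrow> x \<in> {1..n}" for x using permutes_in_image[OF \<pi>] .
  have one: "(1::nat) \<in> {1..n}" using n by simp
  have "orbit \<tau> (\<pi> 1) = {(\<tau> ^^ i) (\<pi> 1) | i. True}"
    using perm by (intro orbit_altdef_permutation) (auto simp: permutation_permutes)
  also have "\<dots> = {\<pi> (i mod n + 1) | i. True}"
    using one by (simp add: pow nxt_pow)
  also have "\<dots> = \<pi> ` {1..n}"
  proof -
    have "\<pi> x \<in> {\<pi> (i mod n + 1) | i. True}" if "x \<in> {1..n}" for x
      using that by (intro CollectI exI[of _ "x - 1"]) auto
    moreover have "i mod n + 1 \<in> {1..n}" for i using n by (simp add: Suc_leI)
    ultimately show ?thesis by blast
  qed
  also have "\<dots> = {1..n}" using permutes_image[OF \<pi>] .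
  finally have "cyclic_on \<tau> {1..n}"
    using \<pi>in one unfolding cyclic_on_def by metis
  then have cyc: "\<tau> \<in> cyclic_perms n" using perm by (simp add: cyclic_perms_def)
  have listing: "orbit_listing n \<tau> (\<pi> 1) = \<pi>"
  proof
    fix i show "orbit_listing n \<tau> (\<pi> 1) i = \<pi> i"
    proof (cases "i \<in> {1..n}")
      case True
      then show ?thesis using one by (auto simp: orbit_listing_def pow nxt_pow)
    next
      case False
      then show ?thesis using permutes_not_in[OF \<pi> False] by (simp only: orbit_listing_def if_False)
    qed
  qed
  have itin: "itinerary \<tau> L (\<pi> x) = W x" if "x \<in> {1..n}" for x
    using that by (auto simp: itinerary_def pow nxt_pow L_def mod W_nth)
  have L0: "L (\<pi> x) = W x 0" if "x \<in> {1..n}" for x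
    using that by (simp add: L_def W_nth)
  have ex: "\<exists>x'\<in>{1..n}. x = \<pi> x'" if "x \<in> {1..n}" for x
    using that permutes_image[OF \<pi>] by blast
  have "mono_on {1..n} L"
  proof (rule mono_onI)
    fix x y assume xy: "x \<in> {1..n}" "y \<in> {1..n}" "x \<le> y"
    then obtain x' y' where "x' \<in> {1..n}" "y' \<in> {1..n}" "x = \<pi> x'" "y = \<pi> y'"
      using ex[OF xy(1)] ex[OF xy(2)] by blast
    then show "L x \<le> L y" using ord xy(3) alt_less_head L0 by (metis le_less)
  qed
  moreover have "\<tau> y < \<tau> x" if xy: "x \<in> {1..n}" "y \<in> {1..n}" "x < y" "L x = L y" for x y
  proof -
    obtain x' y' where x': "x' \<in> {1..n}" "y' \<in> {1..n}" "x = \<pi> x'" "y = \<pi> y'"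
      using ex[OF xy(1)] ex[OF xy(2)] by blast
    \<comment> \<open>Shifting the word at position \<open>z\<close> gives the word at the next
      position; at \<open>z = n\<close> this wraps around by periodicity.\<close>
    have tl: "(\<lambda>i. W z (Suc i)) = W (nxt z)" if "z \<in> {1..n}" for z
    proof -
      have "nxt z \<in> {1..n}" using that permutes_in_image[OF nxt] by blast
      then show ?thesis
        using itin[OF that] itin[of "nxt z"] itinerary_funpow[of \<tau> L 1 "\<pi> z"]
        by (simp add: \<tau>\<pi> fun_eq_iff)
    qed
    have "alt_less (W (nxt y')) (W (nxt x'))"
      using alt_less_tail[of "W x'" "W y'"] ord[OF x'(1,2)] xy x' L0 by (simp add: tl)
    then show ?thesis
      using ord[of "nxt y'" "nxt x'"] x' permutes_in_image[OF nxt] by (simp add: \<tau>\<pi>)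
  qed
  ultimately have "descending_labelling n \<tau> L" by (auto simp: descending_labelling_def)
  moreover have "inj_on (itinerary \<tau> L) {1..n}"
    by (rule inj_onI) (metis ex itin W_inj)
  moreover have "L ` {1..n} \<subseteq> {..<k}"
    using s by (auto simp: L_def words_def streams_iff_snth)
  ultimately have "\<tau> \<in> realizable n k" using cyc by (auto simp: realizable_def)
  then show ?thesis using that[of \<tau> "\<pi> 1"] listing pat \<pi>in one by simp
qed

lemma card_periodic_patterns:
  "card (periodic_patterns (reverse_shift k) n) = card (realizable n k) * n"
proof -
  have "periodic_patterns (reverse_shift k) n =
      (\<lambda>(\<tau>, a). orbit_listing n \<tau> a) ` (realizable n k \<times> {1..n})" (is "?P = ?Q")
  proof
    show "?Q \<subseteq> ?P" using orbit_listing_in_periodic_patterns by auto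
    show "?P \<subseteq> ?Q"
    proof
      fix \<pi> assume "\<pi> \<in> ?P"
      then obtain s where "s \<in> periodic_words k n" "\<pi> = pattern (reverse_shift k) n s"
        by (auto simp: periodic_patterns_def reverse_shift_def)
      then show "\<pi> \<in> ?Q" by (elim pattern_is_orbit_listing) force
    qed
  qed
  moreover have "inj_on (\<lambda>(\<tau>, a). orbit_listing n \<tau> a) (realizable n k \<times> {1..n})"
    by (rule inj_on_subset[OF inj_on_orbit_listing]) (auto simp: realizable_def)
  ultimately show ?thesis by (simp add: card_image card_cartesian_product)
qed

subsection \<open>Labellings and ascents\<close>

text \<open>The elements of \<open>A\<close> act as breakpoints: equal labels at
  \<open>x < y\<close> mean that no ascent lies in between, so \<open>\<tau>\<close> falls at each
  step from \<open>x\<close> to \<open>y\<close>. Allowing \<open>A\<close> to exceed the ascents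
  leaves room for an extra breakpoint.\<close>

lemma descending_labelling_card_below:
  assumes perm: "\<tau> permutes {1..n}" and A: "finite A" "ascents n \<tau> \<subseteq> A"
  shows "descending_labelling n \<tau> (\<lambda>x. card {i \<in> A. i < x})"
  unfolding descending_labelling_def
proof (intro conjI ballI impI)
  show "mono_on {1..n} (\<lambda>x. card {i \<in> A. i < x})"
    using A(1) by (intro mono_onI card_mono) auto
next
  fix x y assume x: "x \<in> {1..n}" and y: "y \<in> {1..n}"
    and *: "x < y \<and> card {i \<in> A. i < x} = card {i \<in> A. i < y}"
  have "{i \<in> A. i < x} = {i \<in> A. i < y}"
    using A(1) * by (intro card_subset_eq) auto
  then have no: "i \<notin> A" if "x \<le> i" "i < y" for i using that not_less by blast
  have desc: "\<tau> (Suc i) < \<tau> i" if "x \<le> i" "i < y" for i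
  proof -
    have "\<not> \<tau> i < \<tau> (Suc i)" 
      using no[OF that] subsetD[OF A(2), of i] that x y by (auto simp: ascents_def)
    moreover have "\<tau> i \<noteq> \<tau> (Suc i)" using permutes_inj[OF perm] by (metis injD n_not_Suc_n)
    ultimately show ?thesis by linarith
  qed
  have "Suc x \<le> z \<Longrightarrow> z \<le> y \<Longrightarrow> \<tau> z < \<tau> x" for z
  proof (induction z rule: dec_induct)
    case base then show ?case using desc[of x] * by simp
  next
    case (step z) then show ?case using desc[of z] by simp
  qed
  then show "\<tau> y < \<tau> x" using * by auto
qed

lemma finite_ascents: "finite (ascents n \<tau>)"
  by (simp add: ascents_def)

text \<open>The label must grow strictly at an ascent, since equal labels would force a descent
  there.\<close>

lemma labelling_increment_ge_ascents:
  assumes L: "descending_labelling n \<tau> L" and "1 \<le> x" "x \<le> y" "y \<le> n"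
  shows "L x + card {i \<in> ascents n \<tau>. x \<le> i \<and> i < y} \<le> L y"
  using assms(3,4)
proof (induction y rule: dec_induct)
  case base
  have "{i \<in> ascents n \<tau>. x \<le> i \<and> i < x} = {}" by auto
  then show ?case by simp
next
  case (step y)
  have y: "y \<in> {1..n}" "Suc y \<in> {1..n}" using step assms(2) by auto
  have le: "L y \<le> L (Suc y)"
    using L y by (auto simp: descending_labelling_def intro: mono_onD)
  show ?case
  proof (cases "y \<in> ascents n \<tau>")
    case True
    then have "{i \<in> ascents n \<tau>. x \<le> i \<and> i < Suc y} =
        insert y {i \<in> ascents n \<tau>. x \<le> i \<and> i < y}"
      using step by auto
    then have "card {i \<in> ascents n \<tau>. x \<le> i \<and> i < Suc y} =
        Suc (card {i \<in> ascents n \<tau>. x \<le> i \<and> i < y})"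
      using finite_ascents by simp
    moreover have "L y \<noteq> L (Suc y)"
      using L y True unfolding descending_labelling_def ascents_def by fastforce
    ultimately show ?thesis using step le by simp
  next
    case False
    then have "{i \<in> ascents n \<tau>. x \<le> i \<and> i < Suc y} =
        {i \<in> ascents n \<tau>. x \<le> i \<and> i < y}"
      by (auto simp: less_Suc_eq)
    then show ?thesis using step le by simp
  qed
qed

lemma ascents_split:
  assumes "1 \<le> x" "x \<le> n"
  shows "card (ascents n \<tau>) =
    card {i \<in> ascents n \<tau>. 1 \<le> i \<and> i < x} + card {i \<in> ascents n \<tau>. x \<le> i \<and> i < n}"
proof -
  have "ascents n \<tau> = {i \<in> ascents n \<tau>. 1 \<le> i \<and> i < x} \<union> {i \<in> ascents n \<tau>. x \<le> i \<and> i < n}"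
    by (auto simp: ascents_def)
  then have "card (ascents n \<tau>) =
    card ({i \<in> ascents n \<tau>. 1 \<le> i \<and> i < x} \<union> {i \<in> ascents n \<tau>. x \<le> i \<and> i < n})"
    by simp
  also have "\<dots> = card {i \<in> ascents n \<tau>. 1 \<le> i \<and> i < x} + card {i \<in> ascents n \<tau>. x \<le> i \<and> i < n}"
    using finite_ascents by (intro card_Un_disjoint) auto
  finally show ?thesis .
qed

lemma ascents_lt_labels:
  assumes "descending_labelling n \<tau> L" "L ` {1..n} \<subseteq> {..<k}" "n > 0"
  shows "card (ascents n \<tau>) < k"
proof -
  have "L 1 + card {i \<in> ascents n \<tau>. 1 \<le> i \<and> i < n} \<le> L n"
    using assms by (intro labelling_increment_ge_ascents) auto
  moreover have "{i \<in> ascents n \<tau>. 1 \<le> i \<and> i < n} = ascents n \<tau>"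
    by (auto simp: ascents_def)
  moreover have "n \<in> {1..n}" using assms(3) by simp
  then have "L n < k" using assms(2) by blast
  ultimately show ?thesis by simp
qed

text \<open>The total increase of \<open>L\<close> is at most \<open>k - 1\<close>, which is the
  number of ascents. The lower bounds before and after \<open>x\<close> therefore hold with
  equality, and \<open>L 1\<close> is 0.\<close>

lemma labelling_unique:
  assumes L: "descending_labelling n \<tau> L" "L ` {1..n} \<subseteq> {..<k}"
    and k: "card (ascents n \<tau>) + 1 = k" and x: "x \<in> {1..n}"
  shows "L x = card {i \<in> ascents n \<tau>. i < x}"
proof -
  have 1: "L 1 + card {i \<in> ascents n \<tau>. 1 \<le> i \<and> i < x} \<le> L x"
    using L x by (intro labelling_increment_ge_ascents) auto
  have 2: "L x + card {i \<in> ascents n \<tau>. x \<le> i \<and> i < n} \<le> L n"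
    using L x by (intro labelling_increment_ge_ascents) auto
  have "n \<in> {1..n}" using x by auto
  then have 3: "L n < k" using L by blast
  have 4: "{i \<in> ascents n \<tau>. 1 \<le> i \<and> i < x} = {i \<in> ascents n \<tau>. i < x}"
    by (auto simp: ascents_def)
  have "card (ascents n \<tau>) =
    card {i \<in> ascents n \<tau>. 1 \<le> i \<and> i < x} + card {i \<in> ascents n \<tau>. x \<le> i \<and> i < n}"
    using x by (intro ascents_split) auto
  then show ?thesis using 1 2 3 4 k by simp
qed

text \<open>A spare label isolates the point 1, and every other point eventually visits it.\<close>

lemma realizable_if_spare_label:
  assumes \<tau>: "\<tau> \<in> cyclic_perms n" and k: "card (ascents n \<tau>) + 1 < k"
  shows "\<tau> \<in> realizable n k"
proof -
  have perm: "\<tau> permutes {1..n}" and cyc: "cyclic_on \<tau> {1..n}"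
    using \<tau> by (auto simp: cyclic_perms_def)
  \<comment> \<open>With a breakpoint at 1, the point 1 is the only one labelled 0, at the cost of
    at most one more label.\<close>
  define A where "A = insert 1 (ascents n \<tau>)"
  define L where "L x = card {i \<in> A. i < x}" for x
  have fin: "finite A" using finite_ascents by (simp add: A_def)
  have "card A < k" using k card_insert_le_m1[of "Suc (card (ascents n \<tau>))" "ascents n \<tau>" 1]
    by (simp add: A_def)
  moreover have "L x \<le> card A" for x unfolding L_def using fin by (intro card_mono) auto
  ultimately have "L ` {1..n} \<subseteq> {..<k}" using le_less_trans by blast
  moreover have "descending_labelling n \<tau> L"
    unfolding L_def using perm fin by (rule descending_labelling_card_below) (auto simp: A_def)
  moreover have "inj_on (itinerary \<tau> L) {1..n}"
  proof (rule inj_onI, rule ccontr)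
    fix x y assume xy: "x \<in> {1..n}" "y \<in> {1..n}" "itinerary \<tau> L x = itinerary \<tau> L y" "x \<noteq> y"
    have "(1::nat) \<in> {1..n}" using xy by simp
    then obtain i where i: "(\<tau> ^^ i) x = 1" using cyclic_on_reach[OF cyc xy(1)] by metis
    have "inj (\<tau> ^^ i)" using permutes_inj[OF perm] by (rule inj_fn)
    then have "(\<tau> ^^ i) y \<noteq> 1" using i xy(4) by (metis injD)
    moreover have "(\<tau> ^^ i) y \<in> {1..n}" using cyclic_on_funpow_in[OF cyc xy(2)] .
    ultimately have "1 \<in> {j \<in> A. j < (\<tau> ^^ i) y}" by (auto simp: A_def)
    then have "L ((\<tau> ^^ i) y) > 0" unfolding L_def using fin by (auto simp: card_gt_0_iff)
    moreover have "{j \<in> A. j < 1} = {}" by (auto simp: A_def ascents_def)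
    then have "L 1 = 0" by (simp add: L_def)
    moreover have "L ((\<tau> ^^ i) x) = L ((\<tau> ^^ i) y)"
      using fun_cong[OF xy(3), of i] by (simp add: itinerary_def)
    ultimately show False using i by simp
  qed
  ultimately show ?thesis using \<tau> by (auto simp: realizable_def)
qed

text \<open>Any admissible labelling agrees with the ascent count along whole orbits, so the
  existential quantifier over labellings reduces to one explicit candidate.\<close>

lemma realizable_iff_if_tight:
  assumes \<tau>: "\<tau> \<in> cyclic_perms n" and k: "card (ascents n \<tau>) + 1 = k"
  shows "\<tau> \<in> realizable n k \<longleftrightarrow>
    inj_on (itinerary \<tau> (\<lambda>x. card {i \<in> ascents n \<tau>. i < x})) {1..n}"
    (is "_ \<longleftrightarrow> inj_on (itinerary \<tau> ?L) _")
proof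
  assume "\<tau> \<in> realizable n k"
  then obtain L where L: "L ` {1..n} \<subseteq> {..<k}" "descending_labelling n \<tau> L"
      "inj_on (itinerary \<tau> L) {1..n}"
    by (auto simp: realizable_def)
  have "itinerary \<tau> L x = itinerary \<tau> ?L x" if "x \<in> {1..n}" for x
  proof -
    have "(\<tau> ^^ i) x \<in> {1..n}" for i
      using \<tau> that cyclic_on_funpow_in[of \<tau> "{1..n}" x] by (simp add: cyclic_perms_def)
    from labelling_unique[OF L(2,1) k this] show ?thesis by (simp add: itinerary_def)
  qed
  then show "inj_on (itinerary \<tau> ?L) {1..n}" using L(3) by (metis (no_types, lifting) inj_on_cong)
next
  assume "inj_on (itinerary \<tau> ?L) {1..n}"
  moreover have "descending_labelling n \<tau> ?L"
    using \<tau> finite_ascents by (intro descending_labelling_card_below) (auto simp: cyclic_perms_def)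
  moreover have "?L x \<le> card (ascents n \<tau>)" for x
    using finite_ascents by (intro card_mono) auto
  then have "?L ` {1..n} \<subseteq> {..<k}" using k by (auto simp: less_Suc_eq_le)
  ultimately show "\<tau> \<in> realizable n k" using \<tau> unfolding realizable_def by blast
qed

subsection \<open>Inflation of a permutation by decreasing pairs\<close>

text \<open>Each point \<open>a\<close> is replaced by the block \<open>{2a-1, 2a}\<close>; blocks
  move as \<open>\<rho>\<close> prescribes and every move flips the block.\<close>

definition inflate :: "nat \<Rightarrow> (nat \<Rightarrow> nat) \<Rightarrow> nat \<Rightarrow> nat" where
  "inflate d \<rho> x = (if x \<in> {1..2*d} then
     (if even x then 2 * \<rho> (x div 2) - 1 else 2 * \<rho> ((x + 1) div 2)) else x)"

lemma inflate_even: "a \<in> {1..d} \<Longrightarrow> inflate d \<rho> (2 * a) = 2 * \<rho> a - 1"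
  by (simp add: inflate_def)

lemma inflate_odd: "a \<in> {1..d} \<Longrightarrow> inflate d \<rho> (2 * a - 1) = 2 * \<rho> a"
  by (auto simp: inflate_def)

lemma pair_cases:
  fixes x d :: nat
  assumes "x \<in> {1..2 * d}"
  obtains a where "a \<in> {1..d}" "x = 2 * a - 1" | a where "a \<in> {1..d}" "x = 2 * a"
proof (cases "even x")
  case True
  then obtain a where "x = 2 * a" by blast
  then show ?thesis using assms that(2)[of a] by auto
next
  case False
  then obtain a where "x = 2 * a + 1" by (blast elim: oddE)
  then show ?thesis using assms that(1)[of "a + 1"] by auto
qed

lemma inflate_funpow:
  assumes "\<rho> permutes {1..d}" "a \<in> {1..d}"
  shows "(inflate d \<rho> ^^ i) (2 * a - 1) =
      (if even i then 2 * (\<rho> ^^ i) a - 1 else 2 * (\<rho> ^^ i) a)"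
    and "(inflate d \<rho> ^^ i) (2 * a) =
      (if even i then 2 * (\<rho> ^^ i) a else 2 * (\<rho> ^^ i) a - 1)"
proof -
  have in_dom: "(\<rho> ^^ i) a \<in> {1..d}" for i
    using assms permutes_in_image[OF assms(1)] by (induction i) auto
  show "(inflate d \<rho> ^^ i) (2 * a - 1) =
      (if even i then 2 * (\<rho> ^^ i) a - 1 else 2 * (\<rho> ^^ i) a)"
    by (induction i) (use inflate_even[OF in_dom] inflate_odd[OF in_dom] in auto)
  show "(inflate d \<rho> ^^ i) (2 * a) =
      (if even i then 2 * (\<rho> ^^ i) a else 2 * (\<rho> ^^ i) a - 1)"
    by (induction i) (use inflate_even[OF in_dom] inflate_odd[OF in_dom] in auto)
qed

lemma inflate_permutes:
  assumes \<rho>: "\<rho> permutes {1..d}"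
  shows "inflate d \<rho> permutes {1..2*d}"
proof (rule bij_imp_permutes)
  have "{1..2*d} \<subseteq> inflate d \<rho> ` {1..2*d}"
  proof
    fix y assume "y \<in> {1..2*d}"
    then show "y \<in> inflate d \<rho> ` {1..2*d}"
    proof (cases rule: pair_cases)
      case (1 b)
      then obtain a where "a \<in> {1..d}" "b = \<rho> a" using permutes_image[OF \<rho>] by blast
      then show ?thesis using 1 inflate_even[of a d \<rho>] by (intro image_eqI[of _ _ "2 * a"]) auto
    next
      case (2 b)
      then obtain a where "a \<in> {1..d}" "b = \<rho> a" using permutes_image[OF \<rho>] by blast
      then show ?thesis using 2 inflate_odd[of a d \<rho>] by (intro image_eqI[of _ _ "2 * a - 1"]) auto
    qed
  qed
  moreover have "inflate d \<rho> ` {1..2*d} \<subseteq> {1..2*d}"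
  proof clarify
    fix x assume "x \<in> {1..2*d}"
    then show "inflate d \<rho> x \<in> {1..2*d}"
    proof (cases rule: pair_cases)
      case (1 a)
      then have "\<rho> a \<in> {1..d}" using permutes_in_image[OF \<rho>] by blast
      then show ?thesis using 1 inflate_odd[of a d \<rho>] by auto
    next
      case (2 a)
      then have "\<rho> a \<in> {1..d}" using permutes_in_image[OF \<rho>] by blast
      then show ?thesis using 2 inflate_even[of a d \<rho>] by auto
    qed
  qed
  ultimately have im: "inflate d \<rho> ` {1..2*d} = {1..2*d}" by blast
  then have "inj_on (inflate d \<rho>) {1..2*d}" by (intro eq_card_imp_inj_on) auto
  then show "bij_betw (inflate d \<rho>) {1..2*d} {1..2*d}" using im by (simp add: bij_betw_def)
qed (auto simp: inflate_def)

text \<open>After \<open>d\<close> steps a block returns to itself, flipped \<open>d\<close> times.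
  As \<open>d\<close> is odd, its two points are exchanged, so a single orbit contains both.\<close>

lemma inflate_cyclic:
  assumes \<rho>: "\<rho> \<in> cyclic_perms d" and "odd d"
  shows "inflate d \<rho> \<in> cyclic_perms (2 * d)"
proof -
  have perm: "\<rho> permutes {1..d}" and cyc: "cyclic_on \<rho> {1..d}"
    using \<rho> by (auto simp: cyclic_perms_def)
  let ?\<tau> = "inflate d \<rho>"
  have \<tau>: "?\<tau> permutes {1..2*d}" using inflate_permutes[OF perm] .
  have one: "1 \<in> {1..d}" using \<open>odd d\<close> by (cases d) auto
  have orb: "orbit ?\<tau> 1 = {(?\<tau> ^^ i) 1 | i. True}"
    using \<tau> by (intro orbit_altdef_permutation) (auto simp: permutation_permutes)
  have pow: "(?\<tau> ^^ i) 1 = (if even i then 2 * (\<rho> ^^ i) 1 - 1 else 2 * (\<rho> ^^ i) 1)" for i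
    using inflate_funpow(1)[OF perm one] by simp
  have "{1..2*d} \<subseteq> orbit ?\<tau> 1"
  proof
    fix y assume "y \<in> {1..2*d}"
    then obtain b where b: "b \<in> {1..d}" "y = 2 * b - 1 \<or> y = 2 * b" by (metis pair_cases)
    obtain i where i: "(\<rho> ^^ i) 1 = b" using cyclic_on_reach[OF cyc one b(1)] by metis
    have "(\<rho> ^^ (i + d)) 1 = b"
      using i cyclic_on_funpow_card(2)[OF cyc one] by (simp add: funpow_add)
    then have "y = (?\<tau> ^^ i) 1 \<or> y = (?\<tau> ^^ (i + d)) 1"
      using i b(2) \<open>odd d\<close> pow[of i] pow[of "i + d"] by (cases "even i") auto
    then show "y \<in> orbit ?\<tau> 1" unfolding orb by blast
  qed
  moreover have "orbit ?\<tau> 1 \<subseteq> {1..2*d}"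
    using \<tau> one by (intro permutes_orbit_subset) auto
  ultimately have "{1..2*d} = orbit ?\<tau> 1" by blast
  moreover have "(1::nat) \<in> {1..2*d}" using one by simp
  ultimately have "cyclic_on ?\<tau> {1..2*d}" by (rule cyclic_on_singleI[rotated])
  then show ?thesis using \<tau> by (simp add: cyclic_perms_def)
qed

text \<open>A flipped block is a descent inside. Between consecutive blocks the values
  \<open>2 * \<rho> a - 1\<close> and \<open>2 * \<rho> (a + 1)\<close> compare as
  \<open>\<rho> a\<close> and \<open>\<rho> (a + 1)\<close> do, because these differ.\<close>

lemma ascents_inflate:
  assumes \<rho>: "\<rho> permutes {1..d}"
  shows "ascents (2 * d) (inflate d \<rho>) = (\<lambda>a. 2 * a) ` ascents d \<rho>"
proof -
  have pos: "\<rho> a \<ge> 1" if "a \<in> {1..d}" for a using that permutes_in_image[OF \<rho>] by fastforce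
  have odd: "2 * a - 1 \<notin> ascents (2 * d) (inflate d \<rho>)" if "a \<in> {1..d}" for a
    using inflate_odd[OF that, of \<rho>] inflate_even[OF that, of \<rho>] that by (auto simp: ascents_def)
  have even: "2 * a \<in> ascents (2 * d) (inflate d \<rho>) \<longleftrightarrow> a \<in> ascents d \<rho>" if "a \<in> {1..d}" for a
  proof (cases "a = d")
    case True
    then show ?thesis by (simp add: ascents_def)
  next
    case False
    then have a: "a + 1 \<in> {1..d}" using that by auto
    have "\<rho> a \<noteq> \<rho> (a + 1)" using permutes_inj[OF \<rho>] by (metis injD n_not_Suc_n Suc_eq_plus1)
    then show ?thesis
      using inflate_even[OF that, of \<rho>] inflate_odd[OF a, of \<rho>] that a pos[OF that] pos[OF a]
      by (auto simp: ascents_def)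
  qed
  show ?thesis
  proof (intro equalityI subsetI)
    fix x assume x: "x \<in> ascents (2 * d) (inflate d \<rho>)"
    then have "x \<in> {1..2*d}" by (auto simp: ascents_def)
    then show "x \<in> (\<lambda>a. 2 * a) ` ascents d \<rho>"
      by (cases rule: pair_cases) (use x odd even in auto)
  next
    fix x assume "x \<in> (\<lambda>a. 2 * a) ` ascents d \<rho>"
    then obtain a where "a \<in> ascents d \<rho>" "x = 2 * a" by blast
    moreover from this have "a \<in> {1..d}" by (auto simp: ascents_def)
    ultimately show "x \<in> ascents (2 * d) (inflate d \<rho>)" using even by blast
  qed
qed

lemma card_ascents_inflate:
  "\<rho> permutes {1..d} \<Longrightarrow> card (ascents (2 * d) (inflate d \<rho>)) = card (ascents d \<rho>)"
  by (simp add: ascents_inflate card_image inj_on_def)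

text \<open>All ascents are even, so both points of a block carry the same label. The points 1 and 2
  share a block at all times and hence an itinerary.\<close>

lemma inflate_not_separated:
  assumes \<rho>: "\<rho> permutes {1..d}" and "d > 0"
  shows "\<not> inj_on (itinerary (inflate d \<rho>)
    (\<lambda>x. card {i \<in> ascents (2 * d) (inflate d \<rho>). i < x})) {1..2*d}"
    (is "\<not> inj_on (itinerary _ ?L) _")
proof
  assume inj: "inj_on (itinerary (inflate d \<rho>) ?L) {1..2*d}"
  have one: "1 \<in> {1..d}" using \<open>d > 0\<close> by simp
  have L: "?L (2 * b - 1) = ?L (2 * b)" for b
  proof -
    have "{i \<in> ascents (2 * d) (inflate d \<rho>). i < 2 * b - 1} =
        {i \<in> ascents (2 * d) (inflate d \<rho>). i < 2 * b}"
      by (auto simp: ascents_inflate[OF \<rho>])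
    then show ?thesis by simp
  qed
  have "itinerary (inflate d \<rho>) ?L (2 * 1 - 1) = itinerary (inflate d \<rho>) ?L (2 * 1)"
    unfolding itinerary_def by (rule ext) (simp only: inflate_funpow[OF \<rho> one] L split: if_split, simp)
  then have "2 * 1 - 1 = (2 * 1 :: nat)"
    by (rule inj_onD[OF inj]) (use \<open>d > 0\<close> in auto)
  then show False by simp
qed

lemma inj_on_inflate: "inj_on (inflate d) {\<rho>. \<rho> permutes {1..d}}"
proof (rule inj_onI, rule ext)
  fix \<rho> \<rho>' x
  assume \<rho>: "\<rho> \<in> {\<rho>. \<rho> permutes {1..d}}" "\<rho>' \<in> {\<rho>. \<rho> permutes {1..d}}"
    and eq: "inflate d \<rho> = inflate d \<rho>'"
  show "\<rho> x = \<rho>' x"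
  proof (cases "x \<in> {1..d}")
    case True
    then show ?thesis using fun_cong[OF eq, of "2 * x - 1"] inflate_odd[OF True] by simp
  next
    case False
    then show ?thesis using \<rho> by (metis mem_Collect_eq permutes_not_in)
  qed
qed

text \<open>Without ascents the permutation is decreasing and swaps 1 and \<open>n\<close>, which
  closes a cycle of length 2. This lets the final sum start at \<open>i = 2\<close>.\<close>

lemma cyclic_perm_has_ascent:
  assumes \<tau>: "\<tau> \<in> cyclic_perms n" and "n \<ge> 3"
  shows "ascents n \<tau> \<noteq> {}"
proof
  assume e: "ascents n \<tau> = {}"
  have perm: "\<tau> permutes {1..n}" and cyc: "cyclic_on \<tau> {1..n}"
    using \<tau> by (auto simp: cyclic_perms_def)
  have "descending_labelling n \<tau> (\<lambda>x. card {i \<in> {}. i < x})"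
    using perm e by (intro descending_labelling_card_below) auto
  then have desc: "\<tau> y < \<tau> x" if "x \<in> {1..n}" "y \<in> {1..n}" "x < y" for x y
    using that by (auto simp: descending_labelling_def)
  have mem: "1 \<in> {1..n}" "n \<in> {1..n}" using \<open>n \<ge> 3\<close> by auto
  have im: "\<tau> x \<in> {1..n}" if "x \<in> {1..n}" for x using that permutes_in_image[OF perm] by blast
  obtain x where x: "x \<in> {1..n}" "\<tau> x = n"
    using mem(2) permutes_image[OF perm] by (metis image_iff)
  obtain y where y: "y \<in> {1..n}" "\<tau> y = 1"
    using mem(1) permutes_image[OF perm] by (metis image_iff)
  have "x = 1"
  proof (rule ccontr)
    assume "x \<noteq> 1"
    then show False using desc[OF mem(1) x(1)] im[OF mem(1)] x by auto
  qed
  moreover have "y = n"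
  proof (rule ccontr)
    assume "y \<noteq> n"
    then show False using desc[OF y(1) mem(2)] im[OF mem(2)] y by auto
  qed
  ultimately have "(\<tau> ^^ 2) 1 = 1" using x y by (simp add: numeral_2_eq_2)
  then have "n dvd 2" using cyclic_on_funpow_eq_self_iff[OF cyc mem(1)] by simp
  then show False using \<open>n \<ge> 3\<close> by (auto dest: dvd_imp_le)
qed

subsection \<open>Points with equal itineraries\<close>

lemma unseparated_order:
  assumes perm: "\<tau> permutes {1..n}" and L: "descending_labelling n \<tau> L"
    and xy: "x \<in> {1..n}" "y \<in> {1..n}" "x < y" and eq: "itinerary \<tau> L x = itinerary \<tau> L y"
  shows "if even i then (\<tau> ^^ i) x < (\<tau> ^^ i) y else (\<tau> ^^ i) y < (\<tau> ^^ i) x"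
proof (induction i)
  case 0 then show ?case using xy by simp
next
  case (Suc i)
  have in_dom: "(\<tau> ^^ i) z \<in> {1..n}" if "z \<in> {1..n}" for z
    using permutes_in_image[OF permutes_funpow[OF perm]] that by blast
  have "L ((\<tau> ^^ i) x) = L ((\<tau> ^^ i) y)"
    using fun_cong[OF eq, of i] by (simp add: itinerary_def)
  then show ?case
    using Suc L in_dom[OF xy(1)] in_dom[OF xy(2)]
    by (auto simp: descending_labelling_def split: if_splits)
qed

text \<open>A point squeezed between two orbit points with equal labels gets the same label by
  monotonicity. Then \<open>\<tau>\<close> reverses all three, so the point stays squeezed.\<close>

lemma unseparated_convex:
  assumes perm: "\<tau> permutes {1..n}" and L: "descending_labelling n \<tau> L"
    and xz: "x \<in> {1..n}" "z \<in> {1..n}" and y: "x \<le> y" "y \<le> z"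
    and eq: "itinerary \<tau> L x = itinerary \<tau> L z"
  shows "itinerary \<tau> L x = itinerary \<tau> L y"
proof -
  have dom: "(\<tau> ^^ i) w \<in> {1..n}" if "w \<in> {1..n}" for w i
    using permutes_in_image[OF permutes_funpow[OF perm]] that by blast
  have y': "y \<in> {1..n}" using xz y by auto
  note d = dom[OF xz(1)] dom[OF xz(2)] dom[OF y']
  have mono: "mono_on {1..n} L" using L by (simp add: descending_labelling_def)
  have anti: "\<tau> b \<le> \<tau> a" if "a \<in> {1..n}" "b \<in> {1..n}" "a \<le> b" "L a = L b" for a b
    using L that by (cases "a = b") (auto simp: descending_labelling_def less_imp_le)
  have Leq: "L ((\<tau> ^^ i) x) = L ((\<tau> ^^ i) z)" for i
    using fun_cong[OF eq, of i] by (simp add: itinerary_def)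
  have sq: "L ((\<tau> ^^ i) x) = L ((\<tau> ^^ i) y) \<and> L ((\<tau> ^^ i) y) = L ((\<tau> ^^ i) z)"
    if "(\<tau> ^^ i) x \<le> (\<tau> ^^ i) y \<and> (\<tau> ^^ i) y \<le> (\<tau> ^^ i) z \<or>
      (\<tau> ^^ i) z \<le> (\<tau> ^^ i) y \<and> (\<tau> ^^ i) y \<le> (\<tau> ^^ i) x" for i
    using that
  proof (elim disjE conjE)
    assume "(\<tau> ^^ i) x \<le> (\<tau> ^^ i) y" "(\<tau> ^^ i) y \<le> (\<tau> ^^ i) z"
    from mono_onD[OF mono d(1) d(3) this(1)] mono_onD[OF mono d(3) d(2) this(2)]
    show ?thesis using Leq[of i] by linarith
  next
    assume "(\<tau> ^^ i) z \<le> (\<tau> ^^ i) y" "(\<tau> ^^ i) y \<le> (\<tau> ^^ i) x"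
    from mono_onD[OF mono d(2) d(3) this(1)] mono_onD[OF mono d(3) d(1) this(2)]
    show ?thesis using Leq[of i] by linarith
  qed
  have between: "(\<tau> ^^ i) x \<le> (\<tau> ^^ i) y \<and> (\<tau> ^^ i) y \<le> (\<tau> ^^ i) z \<or>
      (\<tau> ^^ i) z \<le> (\<tau> ^^ i) y \<and> (\<tau> ^^ i) y \<le> (\<tau> ^^ i) x" for i
  proof (induction i)
    case 0 then show ?case using y by simp
  next
    case (Suc i)
    then show ?case
      using sq[OF Suc] anti[OF d(1)[of i] d(3)[of i]] anti[OF d(3)[of i] d(2)[of i]]
        anti[OF d(2)[of i] d(3)[of i]] anti[OF d(3)[of i] d(1)[of i]]
      unfolding funpow.simps comp_apply by metis
  qed
  show ?thesis using sq[OF between] by (auto simp: itinerary_def)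
qed

lemma itinerary_eq_funpow:
  "itinerary \<tau> L x = itinerary \<tau> L y \<Longrightarrow>
    itinerary \<tau> L ((\<tau> ^^ i) x) = itinerary \<tau> L ((\<tau> ^^ i) y)"
  by (simp add: fun_eq_iff itinerary_funpow)

text \<open>The first return map to the set of points sharing the itinerary of 1 is cyclic and
  monotone on it; so it is decreasing and the set is a pair.\<close>

lemma unseparated_return:
  assumes \<tau>: "\<tau> \<in> cyclic_perms n" and L: "descending_labelling n \<tau> L"
    and ninj: "\<not> inj_on (itinerary \<tau> L) {1..n}"
  obtains m where "n = 2 * m" "(\<tau> ^^ m) 1 = 2"
    "{x \<in> {1..n}. itinerary \<tau> L x = itinerary \<tau> L 1} = {1, 2}"
proof -
  have perm: "\<tau> permutes {1..n}" and cyc: "cyclic_on \<tau> {1..n}"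
    using \<tau> by (auto simp: cyclic_perms_def)
  have dom: "(\<tau> ^^ i) w \<in> {1..n}" if "w \<in> {1..n}" for w i
    using cyclic_on_funpow_in[OF cyc that] .
  let ?I = "itinerary \<tau> L"
  obtain x y where xy: "x \<in> {1..n}" "y \<in> {1..n}" "?I x = ?I y" "x \<noteq> y"
    using ninj by (auto simp: inj_on_def)
  then have one: "1 \<in> {1..n}" by auto
  \<comment> \<open>Moving the unseparated pair along the orbit makes 1 one of its members;
    convexity then puts 2 into the class of 1.\<close>
  obtain j where j: "(\<tau> ^^ j) x = 1" using cyclic_on_reach[OF cyc xy(1) one] by metis
  let ?z = "(\<tau> ^^ j) y"
  have z: "?I 1 = ?I ?z" using itinerary_eq_funpow[OF xy(3), of j] j by simp
  have "?z \<noteq> 1" using xy(4) j permutes_inj[OF permutes_funpow[OF perm]] by (metis injD)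
  then have z2: "2 \<le> ?z" "?z \<in> {1..n}" using dom[OF xy(2), of j] by auto
  then have two: "2 \<in> {1..n}" by auto
  have I2: "?I 2 = ?I 1"
    using unseparated_convex[OF perm L one z2(2) _ z2(1) z] by simp
  obtain i2 where i2: "(\<tau> ^^ i2) 1 = 2" using cyclic_on_reach[OF cyc one two] by metis
  define P where "P m \<longleftrightarrow> m > 0 \<and> ?I ((\<tau> ^^ m) 1) = ?I 1" for m
  have "i2 > 0" using i2 by (cases i2) auto
  then have "P i2" using i2 I2 by (simp add: P_def)
  define m where "m = (LEAST m. P m)"
  have Pm: "P m" unfolding m_def using \<open>P i2\<close> by (rule LeastI)
  have m_least: "\<not> P i" if "i < m" for i using that not_less_Least unfolding m_def by blast
  define C where "C = {x \<in> {1..n}. ?I x = ?I 1}"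
  define f where "f = \<tau> ^^ m"
  have fC: "f x \<in> C" if "x \<in> C" for x
    using that dom itinerary_eq_funpow[of \<tau> L x 1 m] Pm by (auto simp: C_def f_def P_def)
  have C1: "1 \<in> C" using one by (simp add: C_def)
  have C2: "2 \<in> C" using two I2 by (simp add: C_def)
  have fpow: "(f ^^ q) x = (\<tau> ^^ (m * q)) x" for q x by (simp add: f_def funpow_mult)
  have fpowC: "(f ^^ q) x \<in> C" if "x \<in> C" for x q
    using that fC by (induction q) auto
  \<comment> \<open>Return times to \<open>C\<close> are multiples of \<open>m\<close>: a nonzero
    remainder would be a smaller positive return time.\<close>
  have orb: "\<exists>q. c = (f ^^ q) 1" if c: "c \<in> C" for c
  proof -
    have "c \<in> {1..n}" using c by (simp add: C_def)
    then obtain i where i: "(\<tau> ^^ i) 1 = c" using cyclic_on_reach[OF cyc one] by metis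
    have "(\<tau> ^^ i) 1 = (\<tau> ^^ (i mod m)) ((f ^^ (i div m)) 1)"
      by (simp add: fpow flip: funpow_add[unfolded comp_def, THEN fun_cong])
    moreover have "?I ((\<tau> ^^ (i mod m)) ((f ^^ (i div m)) 1)) = ?I ((\<tau> ^^ (i mod m)) 1)"
      using fpowC[OF C1] by (intro itinerary_eq_funpow) (simp add: C_def)
    ultimately have "?I ((\<tau> ^^ (i mod m)) 1) = ?I 1" using c i by (simp add: C_def)
    moreover have "\<not> P (i mod m)" using Pm by (intro m_least) (simp add: P_def)
    ultimately have "i mod m = 0" by (simp add: P_def)
    then have "i = m * (i div m)" by auto
    then show ?thesis using i fpow by metis
  qed
  have pre: "\<exists>b\<in>C. f b = c" if c: "c \<in> C" for c
  proof -
    have "(f ^^ n) c = c"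
      using c cyclic_on_funpow_eq_self_iff[OF cyc, of c "m * n"] by (simp add: fpow C_def)
    moreover have "n = Suc (n - 1)" using one by simp
    ultimately have "f ((f ^^ (n - 1)) c) = c" by (metis funpow.simps(2) comp_apply)
    then show ?thesis using fpowC[OF c] by blast
  qed
  have f1: "f 1 \<noteq> 1"
  proof
    assume "f 1 = 1"
    then have "(f ^^ q) 1 = 1" for q by (induction q) auto
    then show False using orb[OF C2] by simp
  qed
  have order: "if even m then f a < f b else f b < f a" if "a \<in> C" "b \<in> C" "a < b" for a b
    unfolding f_def using that by (intro unseparated_order[OF perm L]) (auto simp: C_def)
  have C_pos: "1 \<le> c" if "c \<in> C" for c using that by (simp add: C_def)
  obtain c where c: "c \<in> C" "f c = 1" using pre[OF C1] by blast
  have "1 < c" using c f1 C_pos[OF c(1)] by (cases "c = 1") auto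
  \<comment> \<open>For even \<open>m\<close> the map \<open>f\<close> would be increasing on
    \<open>C\<close>, and \<open>f 1\<close> would lie below \<open>f c = 1\<close>.\<close>
  have oddm: "odd m"
    using order[OF C1 c(1) \<open>1 < c\<close>] c(2) C_pos[OF fC[OF C1]] by (auto split: if_splits)
  have finC: "finite C" by (simp add: C_def)
  \<comment> \<open>A decreasing bijection of \<open>C\<close> swaps its extremes 1 and
    \<open>r\<close>. Since the powers of \<open>f\<close> at 1 exhaust \<open>C\<close>, nothing
    else is in it.\<close>
  define r where "r = Max C"
  have r: "r \<in> C" "\<And>x. x \<in> C \<Longrightarrow> x \<le> r" using finC C1 unfolding r_def by (auto intro: Max_in)
  have "c = r"
  proof (rule ccontr)
    assume "c \<noteq> r"
    then have "c < r" using r c by (simp add: le_neq_implies_less)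
    then show False using order[OF c(1) r(1)] oddm c(2) C_pos[OF fC[OF r(1)]] by simp
  qed
  obtain b where b: "b \<in> C" "f b = r" using pre[OF r(1)] by blast
  have "b = 1"
  proof (rule ccontr)
    assume "b \<noteq> 1"
    then have "1 < b" using C_pos[OF b(1)] by simp
    then show False using order[OF C1 b(1)] oddm b(2) r(2)[OF fC[OF C1]] by simp
  qed
  then have f1r: "f 1 = r" and fr1: "f r = 1" using b c \<open>c = r\<close> by auto
  have pow_in: "(f ^^ q) 1 \<in> {1, r}" for q using f1r fr1 by (induction q) auto
  have "C \<subseteq> {1, r}" using orb pow_in by blast
  then have r2: "r = 2" using C2 by auto
  then have C: "C = {1, 2}" using \<open>C \<subseteq> {1, r}\<close> C1 C2 by blast
  have m12: "(\<tau> ^^ m) 1 = 2" using f1r r2 by (simp add: f_def)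
  have "(f ^^ 2) 1 = 1" using f1r fr1 by (simp add: numeral_2_eq_2)
  then have dvd: "n dvd m * 2" using cyclic_on_funpow_eq_self_iff[OF cyc one, of "m * 2"]
    by (simp add: fpow)
  have ndvd: "\<not> n dvd m" using cyclic_on_funpow_eq_self_iff[OF cyc one, of m] m12 by simp
  have "m \<le> n"
  proof (rule ccontr)
    assume "\<not> m \<le> n"
    moreover have "P n" using cyclic_on_funpow_eq_self_iff[OF cyc one, of n] one
      by (simp add: P_def)
    ultimately show False using m_least[of n] by simp
  qed
  \<comment> \<open>Here \<open>n\<close> divides \<open>2 * m\<close> but not \<open>m\<close>, and
    \<open>m \<le> n\<close> because \<open>n\<close> is itself a return time; only
    \<open>t = 1\<close> remains.\<close>
  obtain t where t: "m * 2 = n * t" using dvd by blast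
  have "m > 0" using Pm by (simp add: P_def)
  have "t = 1"
  proof (rule ccontr)
    assume "t \<noteq> 1"
    moreover have "t \<noteq> 0" using t \<open>m > 0\<close> by (cases t) auto
    ultimately have "2 \<le> t" by simp
    then have "n * 2 \<le> m * 2" using t by simp
    then have "n = m" using \<open>m \<le> n\<close> by simp
    then show False using ndvd by simp
  qed
  then have "n = 2 * m" using t by simp
  then show ?thesis using that m12 C by (simp add: C_def)
qed

text \<open>Transporting the class \<open>{1, 2}\<close> around the cycle shows that every class is
  a pair exchanged by the involution \<open>\<tau> ^^ d\<close>. Convexity makes partners adjacent,
  so the classes are the blocks of an inflation.\<close>

lemma unseparated_imp_inflate:
  assumes \<tau>: "\<tau> \<in> cyclic_perms (2 * d)" and L: "descending_labelling (2 * d) \<tau> L"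
    and ninj: "\<not> inj_on (itinerary \<tau> L) {1..2*d}"
  obtains \<rho> where "\<rho> \<in> cyclic_perms d" "\<tau> = inflate d \<rho>"
proof -
  let ?n = "2 * d" and ?I = "itinerary \<tau> L"
  have perm: "\<tau> permutes {1..?n}" and cyc: "cyclic_on \<tau> {1..?n}"
    using \<tau> by (auto simp: cyclic_perms_def)
  have dom: "(\<tau> ^^ i) w \<in> {1..?n}" if "w \<in> {1..?n}" for w i
    using cyclic_on_funpow_in[OF cyc that] .
  obtain m where "?n = 2 * m" "(\<tau> ^^ m) 1 = 2"
    and class1: "{x \<in> {1..?n}. ?I x = ?I 1} = {1, 2}"
    by (rule unseparated_return[OF \<tau> L ninj])
  then have d12: "(\<tau> ^^ d) 1 = 2" by simp
  have one: "1 \<in> {1..?n}" and I2: "?I 2 = ?I 1" using class1 by blast+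
  define p where "p = \<tau> ^^ d"
  have p_dom: "p x \<in> {1..?n}" if "x \<in> {1..?n}" for x using dom[OF that] by (simp add: p_def)
  have pp: "p (p x) = x" if "x \<in> {1..?n}" for x
  proof -
    have "p (p x) = (\<tau> ^^ (d + d)) x" by (simp add: p_def funpow_add)
    also have "\<dots> = x" using cyclic_on_funpow_eq_self_iff[OF cyc that, of "d + d"] by (simp add: mult_2)
    finally show ?thesis .
  qed
  have comm: "p ((\<tau> ^^ i) x) = (\<tau> ^^ i) (p x)" for i x
    by (simp add: p_def flip: funpow_add[unfolded comp_def, THEN fun_cong])
      (simp add: add.commute)
  have p1: "p 1 = 2" using d12 by (simp add: p_def)
  have Ip: "?I (p x) = ?I x" and cls: "\<And>z. z \<in> {1..?n} \<Longrightarrow> ?I x = ?I z \<Longrightarrow> z = x \<or> z = p x"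
    if x: "x \<in> {1..?n}" for x
  proof -
    obtain j where j: "(\<tau> ^^ j) 1 = x" using cyclic_on_reach[OF cyc one x] by metis
    have "?I ((\<tau> ^^ j) (p 1)) = ?I ((\<tau> ^^ j) 1)"
      using I2 p1 by (intro itinerary_eq_funpow) simp
    then show "?I (p x) = ?I x" using j comm[of j 1] by simp
  next
    fix z assume z: "z \<in> {1..?n}" "?I x = ?I z"
    obtain j where j: "(\<tau> ^^ j) x = 1" using cyclic_on_reach[OF cyc x one] by metis
    have "?I ((\<tau> ^^ j) z) = ?I 1" using itinerary_eq_funpow[OF z(2), of j] j by simp
    then have "(\<tau> ^^ j) z \<in> {1, 2}" using class1 dom[OF z(1), of j] by blast
    moreover have "(\<tau> ^^ j) (p x) = 2" using comm[of j x] j p1 by simp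
    moreover have "inj (\<tau> ^^ j)" using permutes_inj[OF permutes_funpow[OF perm]] .
    ultimately show "z = x \<or> z = p x" using j by (metis injD insertE singletonD)
  qed
  have p_ne: "p x \<noteq> x" if "x \<in> {1..?n}" for x
  proof
    assume "p x = x"
    then have "?n dvd d" using cyclic_on_funpow_eq_self_iff[OF cyc that, of d] by (simp add: p_def)
    then show False using one by (auto dest: dvd_imp_le)
  qed
  have p_up: "p x = x + 1" if "x \<in> {1..?n}" "x < p x" for x
  proof -
    have "?I x = ?I (x + 1)"
      by (rule unseparated_convex[OF perm L that(1) p_dom[OF that(1)] _ _ Ip[OF that(1), symmetric]])
        (use that(2) in auto)
    moreover have "x + 1 \<in> {1..?n}" using that p_dom[OF that(1)] by simp
    ultimately have "x + 1 = x \<or> x + 1 = p x" using cls[OF that(1)] by blast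
    then show ?thesis by simp
  qed
  have p_down: "x = p x + 1" if "x \<in> {1..?n}" "p x < x" for x
    using p_up[OF p_dom[OF that(1)]] pp[OF that(1)] that by simp
  \<comment> \<open>Working upwards: the point just below an odd point is already paired with its
    own predecessor, so the odd point must pair with its successor.\<close>
  have "a < d \<Longrightarrow> p (2 * a + 1) = 2 * a + 2" for a
  proof (induction a)
    case 0 then show ?case using p1 by simp
  next
    case (Suc a)
    let ?x = "2 * Suc a + 1"
    have mem: "?x \<in> {1..?n}" "2 * a + 1 \<in> {1..?n}" using Suc by auto
    have "p (2 * a + 2) = 2 * a + 1" using pp[OF mem(2)] Suc by simp
    then have "p ?x \<noteq> 2 * a + 2" using pp[OF mem(1)] by auto
    then have "\<not> p ?x < ?x" using p_down[OF mem(1)] by auto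
    then show ?case using p_up[OF mem(1)] p_ne[OF mem(1)] by simp
  qed
  then have p_odd: "p (2 * a - 1) = 2 * a" if "a \<in> {1..d}" for a
    using that by (cases a) auto
  have p_even: "p (2 * a) = 2 * a - 1" if "a \<in> {1..d}" for a
  proof -
    have "2 * a - 1 \<in> {1..?n}" using that by auto
    from pp[OF this] show ?thesis using p_odd[OF that] by simp
  qed
  define \<rho> where "\<rho> a = (if a \<in> {1..d} then (\<tau> (2 * a) + 1) div 2 else a)" for a
  have key: "\<rho> a \<in> {1..d} \<and> \<tau> (2 * a) = 2 * \<rho> a - 1 \<and> \<tau> (2 * a - 1) = 2 * \<rho> a"
    if a: "a \<in> {1..d}" for a
  proof -
    have mem: "2 * a \<in> {1..?n}" "2 * a - 1 \<in> {1..?n}" using a by auto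
    let ?y = "\<tau> (2 * a)"
    have y: "?y \<in> {1..?n}" using dom[OF mem(1), of 1] by simp
    have py: "p ?y = \<tau> (2 * a - 1)" using comm[of 1 "2 * a"] p_even[OF a] by simp
    have "?I (2 * a) = ?I (2 * a - 1)" using Ip[OF mem(1)] p_even[OF a] by simp
    then have "L (2 * a) = L (2 * a - 1)" 
      unfolding itinerary_def by (metis funpow_0)
    moreover have "2 * a - 1 < 2 * a" using a by simp
    \<comment> \<open>Equal labels make \<open>\<tau>\<close> reverse the block, so
      \<open>?y\<close> is the lower point of its own block and hence odd.\<close>
    ultimately have lt: "?y < p ?y"
      using L mem py unfolding descending_labelling_def by metis
    show ?thesis using y
    proof (cases rule: pair_cases)
      case (1 b)
      then have "\<rho> a = b" using a by (auto simp: \<rho>_def)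
      then show ?thesis using 1 py p_odd[OF 1(1)] by simp
    next
      case (2 b)
      then show ?thesis using lt p_even[OF 2(1)] by simp
    qed
  qed
  have eq: "\<tau> = inflate d \<rho>"
  proof
    fix x show "\<tau> x = inflate d \<rho> x"
    proof (cases "x \<in> {1..?n}")
      case True
      then show ?thesis
        by (cases rule: pair_cases) (use key inflate_even inflate_odd in auto)
    next
      case False
      then show ?thesis using permutes_not_in[OF perm False] by (simp only: inflate_def if_False)
    qed
  qed
  have "inj_on \<rho> {1..d}"
  proof (rule inj_onI)
    fix a b assume ab: "a \<in> {1..d}" "b \<in> {1..d}" "\<rho> a = \<rho> b"
    then have "\<tau> (2 * a) = \<tau> (2 * b)" using key by metis
    then have "2 * a = 2 * b" by (rule injD[OF permutes_inj[OF perm]])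
    then show "a = b" by simp
  qed
  moreover have "\<rho> ` {1..d} \<subseteq> {1..d}" using key by blast
  ultimately have "bij_betw \<rho> {1..d} {1..d}" by (simp add: bij_betw_def endo_inj_surj)
  then have perm\<rho>: "\<rho> permutes {1..d}" by (rule bij_imp_permutes) (auto simp: \<rho>_def)
  \<comment> \<open>The map sending a point to the index of its block intertwines
    \<open>\<tau>\<close> with \<open>\<rho>\<close>, so cyclicity passes to the quotient.\<close>
  have "cyclic_on \<rho> ((\<lambda>x. (x + 1) div 2) ` {1..?n})"
  proof (rule cyclic_on_image[OF cyc])
    fix x assume "x \<in> {1..?n}"
    then show "\<rho> ((x + 1) div 2) = (\<tau> x + 1) div 2"
    proof (cases rule: pair_cases)
      case (1 a)
      then have "(x + 1) div 2 = a" by auto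
      then show ?thesis using key[OF 1(1)] 1(2) by simp
    next
      case (2 a)
      then have "(x + 1) div 2 = a" by auto
      then show ?thesis using 2 by (simp add: \<rho>_def)
    qed
  qed
  moreover have "(\<lambda>x. (x + 1) div 2) ` {1..?n} = {1..d}"
  proof (intro equalityI subsetI)
    fix a assume "a \<in> {1..d}"
    then show "a \<in> (\<lambda>x. (x + 1) div 2) ` {1..?n}" by (intro image_eqI[of _ _ "2 * a"]) auto
  qed auto
  ultimately have "\<rho> \<in> cyclic_perms d" using perm\<rho> by (simp add: cyclic_perms_def)
  then show ?thesis using that eq by blast
qed

text \<open>Too many ascents are excluded by counting labels, and fewer than \<open>k - 1\<close>
  always suffice. In the tight case the obstruction is being an inflation, which keeps the ascent
  number and so restricts \<open>\<rho>\<close> to the same \<open>k\<close>.\<close>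

lemma realizable_eq:
  assumes "odd d"
  shows "realizable (2 * d) k = {\<tau> \<in> cyclic_perms (2 * d). card (ascents (2 * d) \<tau>) + 1 \<le> k} -
    inflate d ` {\<rho> \<in> cyclic_perms d. card (ascents d \<rho>) + 1 = k}"
    (is "?R = ?A - ?B")
proof -
  have d: "d > 0" using \<open>odd d\<close> by (cases d) auto
  have sub: "\<tau> \<in> ?A" if R: "\<tau> \<in> ?R" for \<tau>
  proof -
    obtain L where "L ` {1..2*d} \<subseteq> {..<k}" "descending_labelling (2 * d) \<tau> L"
      and \<tau>: "\<tau> \<in> cyclic_perms (2 * d)"
      using R by (auto simp: realizable_def)
    then have "card (ascents (2 * d) \<tau>) < k" using d by (intro ascents_lt_labels) auto
    then show ?thesis using \<tau> by simp
  qed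
  have iff: "\<tau> \<in> ?R \<longleftrightarrow> \<tau> \<notin> ?B" if "\<tau> \<in> ?A" for \<tau>
  proof (cases "card (ascents (2 * d) \<tau>) + 1 = k")
    case True
    have \<tau>: "\<tau> \<in> cyclic_perms (2 * d)" using that by simp
    let ?L = "\<lambda>x. card {i \<in> ascents (2 * d) \<tau>. i < x}"
    have L: "descending_labelling (2 * d) \<tau> ?L"
      using \<tau> finite_ascents by (intro descending_labelling_card_below) (auto simp: cyclic_perms_def)
    have "\<not> inj_on (itinerary \<tau> ?L) {1..2*d} \<longleftrightarrow> \<tau> \<in> ?B"
    proof
      assume "\<not> inj_on (itinerary \<tau> ?L) {1..2*d}"
      then obtain \<rho> where \<rho>: "\<rho> \<in> cyclic_perms d" "\<tau> = inflate d \<rho>"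
        using unseparated_imp_inflate[OF \<tau> L] by metis
      then have "card (ascents d \<rho>) + 1 = k"
        using True card_ascents_inflate by (auto simp: cyclic_perms_def)
      then show "\<tau> \<in> ?B" using \<rho> by blast
    next
      assume "\<tau> \<in> ?B"
      then obtain \<rho> where "\<rho> permutes {1..d}" "\<tau> = inflate d \<rho>" by (auto simp: cyclic_perms_def)
      then show "\<not> inj_on (itinerary \<tau> ?L) {1..2*d}" using inflate_not_separated d by blast
    qed
    then show ?thesis using realizable_iff_if_tight[OF \<tau> True] by blast
  next
    case False
    then have "\<tau> \<in> ?R" using that by (intro realizable_if_spare_label) auto
    moreover have "\<tau> \<notin> ?B" using False card_ascents_inflate by (auto simp: cyclic_perms_def)
    ultimately show ?thesis by blast
  qed
  show ?thesis using sub iff by blast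
qed

subsection \<open>Counting\<close>

lemma finite_cyclic_perms: "finite (cyclic_perms n)"
  by (rule finite_subset[OF _ finite_permutations[of "{1..n}"]]) (auto simp: cyclic_perms_def)

lemma cyclic_by_ascents_eq:
  "cyclic_by_ascents n i = card {\<tau> \<in> cyclic_perms n. card (ascents n \<tau>) + 1 = i}"
  unfolding cyclic_by_ascents_def cyclic_perms_def by (rule arg_cong[of _ _ card]) auto

lemma card_cyclic_perms_ascents_le:
  assumes "n \<ge> 3"
  shows "card {\<tau> \<in> cyclic_perms n. card (ascents n \<tau>) + 1 \<le> k} =
    (\<Sum>i=2..k. cyclic_by_ascents n i)"
proof -
  have "card (ascents n \<tau>) > 0" if "\<tau> \<in> cyclic_perms n" for \<tau>
    using cyclic_perm_has_ascent[OF that assms] finite_ascents by (simp add: card_gt_0_iff)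
  then have "{\<tau> \<in> cyclic_perms n. card (ascents n \<tau>) + 1 \<le> k} =
      (\<Union>i\<in>{2..k}. {\<tau> \<in> cyclic_perms n. card (ascents n \<tau>) + 1 = i})"
    by fastforce
  moreover have "card (\<Union>i\<in>{2..k}. {\<tau> \<in> cyclic_perms n. card (ascents n \<tau>) + 1 = i}) =
      (\<Sum>i=2..k. card {\<tau> \<in> cyclic_perms n. card (ascents n \<tau>) + 1 = i})"
    by (intro card_UN_disjoint) (auto simp: finite_cyclic_perms)
  ultimately show ?thesis by (simp add: cyclic_by_ascents_eq)
qed

theorem theorem3p16:
  fixes n k :: nat
  assumes "n \<ge> 3" and "n mod 4 = 2" and "k \<ge> 3"
  shows "num_periodic_patterns (reverse_shift k) n =
    (\<Sum>i=2..k. real (cyclic_by_ascents n i)) - real (cyclic_by_ascents (n div 2) k)"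
proof -
  define d where "d = n div 2"
  have n: "n = 2 * d" and "odd d" using assms(2) unfolding d_def by presburger+
  let ?A = "{\<tau> \<in> cyclic_perms n. card (ascents n \<tau>) + 1 \<le> k}"
  let ?D = "{\<rho> \<in> cyclic_perms d. card (ascents d \<rho>) + 1 = k}"
  have "realizable n k = ?A - inflate d ` ?D"
    using realizable_eq[OF \<open>odd d\<close>, of k] n by simp
  \<comment> \<open>Oddness of \<open>d\<close> guarantees that the removed inflations really are
    \<open>n\<close>-cycles, so their full number is subtracted.\<close>
  moreover have "inflate d ` ?D \<subseteq> ?A"
    using inflate_cyclic \<open>odd d\<close> card_ascents_inflate n by (auto simp: cyclic_perms_def)
  moreover have "finite (inflate d ` ?D)" "finite ?A" using finite_cyclic_perms by auto
  moreover have "inj_on (inflate d) ?D"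
    by (rule inj_on_subset[OF inj_on_inflate]) (auto simp: cyclic_perms_def)
  ultimately have "real (card (realizable n k)) = real (card ?A) - real (card ?D)"
    by (simp add: card_Diff_subset card_image of_nat_diff card_mono flip: card_image)
  moreover have "num_periodic_patterns (reverse_shift k) n = real (card (realizable n k))"
    using assms(1) by (simp add: num_periodic_patterns_def card_periodic_patterns)
  ultimately show ?thesis
    using card_cyclic_perms_ascents_le[OF assms(1), of k] cyclic_by_ascents_eq[of d k]
    by (simp add: d_def)
qed

end
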